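(* Let $F:\mathbb{R}^n\times\mathbb{R}_{\ge 0}^p\times\mathbb{R}^m\to\mathbb{R}$, $(x,y,z)\mapsto F(x,y,z)$, be twice continuously differentiable and convex-concave on $\mathbb{R}^n\times(\mathbb{R}_{\ge 0}^p\times\mathbb{R}^m)$ (convex in $x$, concave in $(y,z)$), with non-empty set of saddle points $\mathrm{Saddle}(F)$. Then each point in $\mathrm{Saddle}(F)$ is stable under the projected saddle-point dynamics $$\dot x=-\nabla_xF(x,y,z),\qquad \dot y=[\nabla_yF(x,y,z)]_y^+,\qquad \dot z=\nabla_zF(x,y,z),$$ and the omega-limit set of every solution of these dynamics is contained in the largest invariant set $\mathcal{M}$ in $\mathcal{E}(F)$, where $$\mathcal{E}(F)=\{(x,y,z)\in\mathbb{R}^n\times\mathbb{R}_{\ge 0}^p\times\mathbb{R}^m \;|\; (x-x_*;y-y_*;z-z_* )\in\ker(\overline{H}(x,y,z,x_*,y_*,z_* ))\ \text{for all }(x_*,y_*,z_* )\in\mathrm{Saddle}(F)\},$$ $$\overline{H}(x,y,z,x_*,y_*,z_* )=\int_0^1H(x(s),y(s),z(s))\,ds,\qquad (x(s),y(s),z(s))=(x_*,y_*,z_* )+s(x-x_*,y-y_*,z-z_* ),$$ $$H(x,y,z)=\begin{bmatrix}-\nabla_{xx}F&0&0\\0&\nabla_{yy}F&\nabla_{yz}F\\0&\nabla_{zy}F&\nabla_{zz}F\end{bmatrix}_{(x,y,z)}.$$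
   Context: For $a\in\mathbb{R}$ and $b\ge 0$, $[a]_b^+=a$ if $b>0$ and $[a]_b^+=\max\{0,a\}$ if $b=0$; for vectors $a\in\mathbb{R}^p$, $b\in\mathbb{R}_{\ge0}^p$, $[a]_b^+$ is the vector with components $[a_i]_{b_i}^+$. The notation $(u;w)$ denotes concatenation of column vectors. $F$ is convex-concave on $\mathcal{X}\times\mathcal{Y}$, with $\mathcal{X}=\mathbb{R}^n$ and $\mathcal{Y}=\mathbb{R}_{\ge0}^p\times\mathbb{R}^m$, if $x\mapsto F(x,\tilde y,\tilde z)$ is convex for each fixed $(\tilde y,\tilde z)\in\mathcal{Y}$ and $(y,z)\mapsto F(\tilde x,y,z)$ is concave for each fixed $\tilde x\in\mathcal{X}$. A point $(x_*,y_*,z_* )\in\mathcal{X}\times\mathcal{Y}$ is a saddle point of $F$ if $F(x_*,y,z)\le F(x_*,y_*,z_* )\le F(x,y_*,z_* )$ for all $x\in\mathcal{X}$ and $(y,z)\in\mathcal{Y}$; $\mathrm{Saddle}(F)$ is the set of saddle points. Solutions are understood in the Caratheodory sense: absolutely continuous maps (with values in $\mathbb{R}^n\times\mathbb{R}_{\ge0}^p\times\mathbb{R}^m$) satisfying the differential equation almost everywhere. A set is invariant if every solution starting in it remains in it. The omega-limit set of a solution $\gamma:[0,\infty)\to\mathbb{R}^N$ is the set of all points $w$ such that $\gamma(t_k)\to w$ for some sequence $t_k\to\infty$. Stability of a point is in the usual Lyapunov sense, relative to the domain $\mathbb{R}^n\times\mathbb{R}_{\ge0}^p\times\mathbb{R}^m$.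 *)

theory Defs
  imports "HOL-Analysis.Analysis"
begin

section \<open>Projected differential equations\<close>

text \<open>Absolute continuity on a set \<open>S\<close> of reals (meant for compact intervals): finite collections of
  non-overlapping subintervals of small total length have small total increments.\<close>

definition abs_continuous_on :: "real set \<Rightarrow> (real \<Rightarrow> 'a::real_normed_vector) \<Rightarrow> bool" where
  "abs_continuous_on S g \<longleftrightarrow>
     (\<forall>\<epsilon>>0. \<exists>\<delta>>0. \<forall>P. finite P \<and> (\<forall>(u, v)\<in>P. u \<le> v \<and> {u..v} \<subseteq> S)
          \<and> disjoint_family_on (\<lambda>(u, v). {u<..<v}) P \<and> (\<Sum>(u, v)\<in>P. v - u) < \<delta>
        \<longrightarrow> (\<Sum>(u, v)\<in>P. norm (g v - g u)) < \<epsilon>)"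

text \<open>A Caratheodory solution of \<open>g' = f g\<close> with values in \<open>D\<close> on a time interval \<open>J\<close> starting at
  \<open>0\<close>; on a non-compact \<open>J\<close> such as \<open>{0..}\<close>, absolute continuity means absolute continuity on each
  compact subinterval.\<close>

definition caratheodory_solution ::
  "('a::euclidean_space \<Rightarrow> 'a) \<Rightarrow> 'a set \<Rightarrow> real set \<Rightarrow> (real \<Rightarrow> 'a) \<Rightarrow> bool" where
  "caratheodory_solution f D J g \<longleftrightarrow>
     is_interval J \<and> 0 \<in> J \<and> J \<subseteq> {0..} \<and> g ` J \<subseteq> D
     \<and> (\<forall>a b. {a..b} \<subseteq> J \<longrightarrow> abs_continuous_on {a..b} g)
     \<and> (AE t in lebesgue. t \<in> J \<longrightarrow> (g has_vector_derivative f (g t)) (at t within J))"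

text \<open>Invariance and stability quantify over solutions on arbitrary intervals \<open>J\<close>, so that no solution
  is left out merely for not being given on all of \<open>{0..}\<close>.\<close>

definition invariant_set :: "('a::euclidean_space \<Rightarrow> 'a) \<Rightarrow> 'a set \<Rightarrow> 'a set \<Rightarrow> bool" where
  "invariant_set f D A \<longleftrightarrow>
     (\<forall>J g. caratheodory_solution f D J g \<and> g 0 \<in> A \<longrightarrow> (\<forall>t\<in>J. g t \<in> A))"

definition largest_invariant_subset ::
  "('a::euclidean_space \<Rightarrow> 'a) \<Rightarrow> 'a set \<Rightarrow> 'a set \<Rightarrow> 'a set" where
  "largest_invariant_subset f D E = \<Union>{A. A \<subseteq> E \<and> invariant_set f D A}"

lemma largest_invariant_subset:
  "largest_invariant_subset f D E \<subseteq> E"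
  "invariant_set f D (largest_invariant_subset f D E)"
  "A \<subseteq> E \<Longrightarrow> invariant_set f D A \<Longrightarrow> A \<subseteq> largest_invariant_subset f D E"
  unfolding largest_invariant_subset_def invariant_set_def by blast+

definition omega_limit_set :: "(real \<Rightarrow> 'a::topological_space) \<Rightarrow> 'a set" where
  "omega_limit_set g =
     {w. \<exists>t. filterlim t at_top sequentially \<and> (\<lambda>k::nat. g (t k)) \<longlonglongrightarrow> w}"

definition lyapunov_stable ::
  "('a::euclidean_space \<Rightarrow> 'a) \<Rightarrow> 'a set \<Rightarrow> 'a \<Rightarrow> bool" where
  "lyapunov_stable f D w \<longleftrightarrow>
     (\<forall>\<epsilon>>0. \<exists>\<delta>>0. \<forall>J g. caratheodory_solution f D J g \<and> dist (g 0) w < \<delta>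
        \<longrightarrow> (\<forall>t\<in>J. dist (g t) w < \<epsilon>))"


section \<open>Convex-concave functions and saddle points\<close>

definition nonneg_orthant :: "(real^'p) set" where
  "nonneg_orthant = {y. \<forall>i. 0 \<le> y $ i}"

definition saddle_domain :: "((real^'n) \<times> (real^'p) \<times> (real^'m)) set" where
  "saddle_domain = UNIV \<times> nonneg_orthant \<times> UNIV"

definition convex_concave :: "((real^'n) \<times> (real^'p) \<times> (real^'m) \<Rightarrow> real) \<Rightarrow> bool" where
  "convex_concave F \<longleftrightarrow>
     (\<forall>(y, z)\<in>nonneg_orthant \<times> UNIV. convex_on UNIV (\<lambda>x. F (x, y, z)))
     \<and> (\<forall>x. concave_on (nonneg_orthant \<times> UNIV) (\<lambda>(y, z). F (x, y, z)))"

definition Saddle ::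
  "((real^'n) \<times> (real^'p) \<times> (real^'m) \<Rightarrow> real) \<Rightarrow> ((real^'n) \<times> (real^'p) \<times> (real^'m)) set" where
  "Saddle F = {(xs, ys, zs) \<in> saddle_domain.
     \<forall>x. \<forall>y\<in>nonneg_orthant. \<forall>z.
       F (xs, y, z) \<le> F (xs, ys, zs) \<and> F (xs, ys, zs) \<le> F (x, ys, zs)}"


section \<open>Derivatives\<close>

text \<open>All derivatives are taken within the domain, hence one-sided in \<open>y\<close> at the boundary of
  the orthant. The domain is convex with non-empty interior, so they are unique.\<close>

definition twice_cont_differentiable_on ::
  "('a::euclidean_space \<Rightarrow> real) \<Rightarrow> 'a set \<Rightarrow> bool" where
  "twice_cont_differentiable_on f S \<longleftrightarrow>
     (\<exists>(f' :: 'a \<Rightarrow> 'a \<Rightarrow>\<^sub>L real) (f'' :: 'a \<Rightarrow> 'a \<Rightarrow>\<^sub>L 'a \<Rightarrow>\<^sub>L real).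
        (\<forall>w\<in>S. (f has_derivative blinfun_apply (f' w)) (at w within S))
      \<and> (\<forall>w\<in>S. (f' has_derivative blinfun_apply (f'' w)) (at w within S))
      \<and> continuous_on S f'')"

definition gradient :: "(real^'k \<Rightarrow> real) \<Rightarrow> (real^'k) filter \<Rightarrow> real^'k" where
  "gradient f net = (\<chi> i. frechet_derivative f net (axis i 1))"

context
  fixes F :: "(real^'n) \<times> (real^'p) \<times> (real^'m) \<Rightarrow> real"
begin

definition grad_x :: "(real^'n) \<times> (real^'p) \<times> (real^'m) \<Rightarrow> real^'n" where
  "grad_x = (\<lambda>(x, y, z). gradient (\<lambda>x'. F (x', y, z)) (at x))"

definition grad_y :: "(real^'n) \<times> (real^'p) \<times> (real^'m) \<Rightarrow> real^'p" where
  "grad_y = (\<lambda>(x, y, z). gradient (\<lambda>y'. F (x, y', z)) (at y within nonneg_orthant))"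

definition grad_z :: "(real^'n) \<times> (real^'p) \<times> (real^'m) \<Rightarrow> real^'m" where
  "grad_z = (\<lambda>(x, y, z). gradient (\<lambda>z'. F (x, y, z')) (at z))"

definition hess_xx :: "(real^'n) \<times> (real^'p) \<times> (real^'m) \<Rightarrow> real^'n^'n" where
  "hess_xx = (\<lambda>(x, y, z). jacobian (\<lambda>x'. grad_x (x', y, z)) (at x))"

definition hess_yy :: "(real^'n) \<times> (real^'p) \<times> (real^'m) \<Rightarrow> real^'p^'p" where
  "hess_yy = (\<lambda>(x, y, z). jacobian (\<lambda>y'. grad_y (x, y', z)) (at y within nonneg_orthant))"

text \<open>\<open>hess_yz\<close> has \<open>p\<close> rows and \<open>m\<close> columns.\<close>

definition hess_yz :: "(real^'n) \<times> (real^'p) \<times> (real^'m) \<Rightarrow> real^'m^'p" where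
  "hess_yz = (\<lambda>(x, y, z). jacobian (\<lambda>z'. grad_y (x, y, z')) (at z))"

definition hess_zy :: "(real^'n) \<times> (real^'p) \<times> (real^'m) \<Rightarrow> real^'p^'m" where
  "hess_zy = (\<lambda>(x, y, z). jacobian (\<lambda>y'. grad_z (x, y', z)) (at y within nonneg_orthant))"

definition hess_zz :: "(real^'n) \<times> (real^'p) \<times> (real^'m) \<Rightarrow> real^'m^'m" where
  "hess_zz = (\<lambda>(x, y, z). jacobian (\<lambda>z'. grad_z (x, y, z')) (at z))"

end


section \<open>The projected saddle-point dynamics\<close>

definition pos_proj :: "real \<Rightarrow> real \<Rightarrow> real" where
  "pos_proj a b = (if b > 0 then a else max 0 a)"

definition pos_proj_vec :: "real^'p \<Rightarrow> real^'p \<Rightarrow> real^'p" where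
  "pos_proj_vec a b = (\<chi> i. pos_proj (a $ i) (b $ i))"

definition psp_field ::
  "((real^'n) \<times> (real^'p) \<times> (real^'m) \<Rightarrow> real) \<Rightarrow>
     (real^'n) \<times> (real^'p) \<times> (real^'m) \<Rightarrow> (real^'n) \<times> (real^'p) \<times> (real^'m)" where
  "psp_field F = (\<lambda>(x, y, z).
     (- grad_x F (x, y, z), pos_proj_vec (grad_y F (x, y, z)) y, grad_z F (x, y, z)))"


section \<open>The set \<open>\<E>(F)\<close>\<close>

definition concat_vec :: "'a^'k \<Rightarrow> 'a^'l \<Rightarrow> 'a^('k + 'l)" where
  "concat_vec u w = (\<chi> i. case i of Inl a \<Rightarrow> u $ a | Inr b \<Rightarrow> w $ b)"

definition block_matrix ::
  "'a^'c^'r \<Rightarrow> 'a^'d^'r \<Rightarrow> 'a^'c^'s \<Rightarrow> 'a^'d^'s \<Rightarrow> 'a^('c + 'd)^('r + 's)" where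
  "block_matrix A B C D =
     (\<chi> i. case i of Inl r \<Rightarrow> concat_vec (A $ r) (B $ r) | Inr s \<Rightarrow> concat_vec (C $ s) (D $ s))"

definition H_mat ::
  "((real^'n) \<times> (real^'p) \<times> (real^'m) \<Rightarrow> real) \<Rightarrow> (real^'n) \<times> (real^'p) \<times> (real^'m)
     \<Rightarrow> real^('n + ('p + 'm))^('n + ('p + 'm))" where
  "H_mat F w = block_matrix
     (- hess_xx F w) 0
     0               (block_matrix (hess_yy F w) (hess_yz F w)
                                   (hess_zy F w) (hess_zz F w))"

definition H_bar ::
  "((real^'n) \<times> (real^'p) \<times> (real^'m) \<Rightarrow> real) \<Rightarrow> (real^'n) \<times> (real^'p) \<times> (real^'m)
     \<Rightarrow> (real^'n) \<times> (real^'p) \<times> (real^'m) \<Rightarrow> real^('n + ('p + 'm))^('n + ('p + 'm))" where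
  "H_bar F w ws = integral {0..1} (\<lambda>s. H_mat F (ws + s *\<^sub>R (w - ws)))"

definition matrix_ker :: "real^'c^'r \<Rightarrow> (real^'c) set" where
  "matrix_ker A = {v. A *v v = 0}"

definition E_set ::
  "((real^'n) \<times> (real^'p) \<times> (real^'m) \<Rightarrow> real) \<Rightarrow> ((real^'n) \<times> (real^'p) \<times> (real^'m)) set" where
  "E_set F = {(x, y, z) \<in> saddle_domain. \<forall>(xs, ys, zs)\<in>Saddle F.
     concat_vec (x - xs) (concat_vec (y - ys) (z - zs)) \<in> matrix_ker (H_bar F (x, y, z) (xs, ys, zs))}"

end

theory Submission
  imports Defs
begin

text \<open>Write \<open>w = (x, y, z)\<close>, let \<open>G = (- grad_x F, grad_y F, grad_z F)\<close> be the saddle operator and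
  \<open>X\<close> the projected field. Everything rests on one inequality: \<open>G\<close> is dissipative, that is
  \<open>(G v - G w) \<bullet> (v - w) \<le> 0\<close> on the domain. It comes from adding the four tangent
  inequalities of the convex functions \<open>F(\<cdot>, y, z)\<close> and of the concave functions
  \<open>F(x, \<cdot>, \<cdot>)\<close> at \<open>v\<close> and \<open>w\<close> (\<open>saddle_operator_le\<close>). Since \<open>G - X\<close> is an
  outward normal of the orthant, \<open>X\<close> is dissipative too.

  Hence the distance of two solutions never increases. Saddle points are equilibria, so comparison
  with a constant solution gives their stability. Comparison of a solution \<open>h\<close> that starts at an omega-limit
  point of \<open>g\<close> with the time shifts of \<open>g\<close> shows that \<open>h\<close> stays in the
  omega-limit set, which is therefore invariant.

  It remains to place the omega-limit set inside \<open>E_set F\<close>. For a saddle point \<open>p\<close> put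
  \<open>\<phi> w = - (G w - G p) \<bullet> (w - p) \<ge> 0\<close>. Along a solution the squared distance to
  \<open>p\<close> decreases at rate at least \<open>2 \<phi>\<close>, and the solution is bounded, hence Lipschitz in time; so it
  cannot come arbitrarily close, at arbitrarily late times, to a point where \<open>\<phi> > 0\<close>, and
  \<open>\<phi> = 0\<close> on the omega-limit set (\<open>omega_limit_no_dissipation\<close>). If \<open>\<phi> w = 0\<close> then the
  function \<open>s \<mapsto> G (p + s d) \<bullet> d\<close> with \<open>d = w - p\<close>, which is nonincreasing, has equal values at
  \<open>0\<close> and \<open>1\<close> and is therefore constant on the segment. Its derivative is the quadratic form of
  \<open>H (p + s d)\<close> at \<open>d\<close>, because the mixed second derivatives cancel. As \<open>H\<close> is symmetric and negative
  semidefinite, \<open>H (p + s d) d = 0\<close> for every \<open>s\<close>, and integration over \<open>s\<close> gives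
  \<open>d \<in> ker H_bar\<close>.

  Two analytic facts are needed along the way: an absolutely continuous function with
  almost everywhere nonpositive derivative is nonincreasing, and the second derivative is symmetric up to the
  boundary of the domain, where only one-sided derivatives exist.\<close>

section \<open>Absolutely continuous functions\<close>

text \<open>Fix \<open>\<epsilon> > 0\<close> and cover the exceptional null set \<open>N\<close> by an open set \<open>U\<close> so small that absolute
  continuity bounds the total variation of \<open>u\<close> over disjoint intervals in \<open>U\<close> by \<open>\<epsilon>\<close>. By Cousin's lemma
  \<open>[a, b]\<close> has a tagged division in which the pieces tagged in \<open>N\<close> lie in \<open>U\<close>, while over every other
  piece \<open>u\<close> grows by at most \<open>\<epsilon>\<close> times the length. Summing the increments gives
  \<open>u b - u a \<le> \<epsilon> (b - a) + \<epsilon>\<close>.\<close>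

lemma abs_continuous_on_nonincreasing:
  fixes u :: "real \<Rightarrow> real"
  assumes ac: "abs_continuous_on {a..b} u" and "a \<le> b"
    and deriv: "AE t in lebesgue. t \<in> {a..b} \<longrightarrow>
      (\<exists>d\<le>0. (u has_vector_derivative d) (at t within {a..b}))"
  shows "u b \<le> u a"
proof -
  obtain N where N: "negligible N" and deriv_off_N:
    "\<And>t. t \<in> {a..b} \<Longrightarrow> t \<notin> N \<Longrightarrow> \<exists>d\<le>0. (u has_vector_derivative d) (at t within {a..b})"
    using deriv unfolding eventually_ae_filter_negligible by blast
  have almost: "u b - u a \<le> \<epsilon> * (b - a) + \<epsilon>" if "\<epsilon> > 0" for \<epsilon>
  proof -
    obtain \<delta> where "\<delta> > 0" and \<delta>:
      "\<And>P. finite P \<Longrightarrow> \<forall>(v, w)\<in>P. v \<le> w \<and> {v..w} \<subseteq> {a..b} \<Longrightarrow>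
         disjoint_family_on (\<lambda>(v, w). {v<..<w}) P \<Longrightarrow> (\<Sum>(v, w)\<in>P. w - v) < \<delta> \<Longrightarrow>
         (\<Sum>(v, w)\<in>P. norm (u w - u v)) < \<epsilon>"
      using ac \<open>\<epsilon> > 0\<close> unfolding abs_continuous_on_def by meson
    obtain U where U: "open U" "N \<subseteq> U" "U - N \<in> lmeasurable" "emeasure lebesgue (U - N) < ennreal \<delta>"
      using sets_lebesgue_outer_open[OF _ \<open>\<delta> > 0\<close>, of N] N
      by (metis negligible_imp_sets)
    have "U = (U - N) \<union> N"
      using U by auto
    then have U_meas: "U \<in> lmeasurable"
      using U(3) N by (metis fmeasurable.Un negligible_imp_measurable)
    have "measure lebesgue U = measure lebesgue (U - N)"
      using N U_meas by (simp add: measure_Diff_null_set negligible_iff_null_sets fmeasurableD)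
    also have "\<dots> < \<delta>"
      using U(3,4) \<open>\<delta> > 0\<close> by (simp add: emeasure_eq_measure2 ennreal_less_iff)
    finally have U_small: "measure lebesgue U < \<delta>" .
    have "\<exists>r>0. (t \<in> N \<longrightarrow> ball t r \<subseteq> U) \<and>
        (t \<notin> N \<longrightarrow> t \<in> {a..b} \<longrightarrow> (\<forall>v\<in>{a..b} \<inter> ball t r.
           (t \<le> v \<longrightarrow> u v - u t \<le> \<epsilon> * (v - t)) \<and> (v \<le> t \<longrightarrow> u t - u v \<le> \<epsilon> * (t - v))))" for t
    proof (cases "t \<in> N \<or> t \<notin> {a..b}")
      case True
      then show ?thesis
        using U(1,2) by (metis open_contains_ball subsetD zero_less_one)
    next
      case False
      then obtain d where "d \<le> 0" and d: "(u has_vector_derivative d) (at t within {a..b})"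
        using deriv_off_N by blast
      then obtain r where "r > 0" and r: "\<And>v. v \<in> {a..b} \<Longrightarrow> norm (v - t) < r \<Longrightarrow>
          norm (u v - u t - (v - t) *\<^sub>R d) \<le> \<epsilon> * norm (v - t)"
        using \<open>\<epsilon> > 0\<close> unfolding has_vector_derivative_def has_derivative_within_alt by blast
      have "(t \<le> v \<longrightarrow> u v - u t \<le> \<epsilon> * (v - t)) \<and> (v \<le> t \<longrightarrow> u t - u v \<le> \<epsilon> * (t - v))"
        if "v \<in> {a..b} \<inter> ball t r" for v
      proof -
        have "\<bar>u v - u t - (v - t) * d\<bar> \<le> \<epsilon> * \<bar>v - t\<bar>"
          using r[of v] that by (auto simp: dist_real_def abs_minus_commute)
        moreover have "(v - t) * d \<le> 0" if "t \<le> v"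
          using that \<open>d \<le> 0\<close> by (simp add: mult_nonneg_nonpos)
        moreover have "(v - t) * d \<ge> 0" if "v \<le> t"
          using that \<open>d \<le> 0\<close> by (simp add: mult_nonpos_nonpos)
        ultimately show ?thesis
          by (auto simp: abs_if split: if_splits)
      qed
      then show ?thesis
        using False \<open>r > 0\<close> by blast
    qed
    then obtain r where r_pos: "\<And>t. r t > 0"
      and r_N: "\<And>t. t \<in> N \<Longrightarrow> ball t (r t) \<subseteq> U"
      and r_off_N: "\<And>t v. t \<notin> N \<Longrightarrow> t \<in> {a..b} \<Longrightarrow> v \<in> {a..b} \<Longrightarrow> v \<in> ball t (r t) \<Longrightarrow>
           (t \<le> v \<longrightarrow> u v - u t \<le> \<epsilon> * (v - t)) \<and> (v \<le> t \<longrightarrow> u t - u v \<le> \<epsilon> * (t - v))"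
      by (metis Int_iff)
    obtain p where p: "p tagged_division_of {a..b}" and fine: "(\<lambda>t. ball t (r t)) fine p"
      using fine_division_exists_real[OF gauge_ball_dependent, of r] r_pos by blast
    note pD = tagged_division_ofD[OF p]
    have interval: "Inf K \<le> x \<and> x \<le> Sup K \<and> K = {Inf K..Sup K} \<and> K \<subseteq> ball x (r x) \<and> K \<subseteq> {a..b}"
      if xK: "(x, K) \<in> p" for x K
    proof -
      obtain c d where K: "K = {c..d}"
        using pD(4)[OF xK] by (auto simp: box_real)
      moreover have "x \<in> K"
        using pD(2)[OF xK] .
      moreover have "K \<subseteq> ball x (r x)"
        using fine xK unfolding fine_def by blast
      ultimately show ?thesis
        using pD(3)[OF xK] by auto
    qed
    have tele: "(\<Sum>(x, K)\<in>p. f (Sup K) - f (Inf K)) = f b - f a" for f :: "real \<Rightarrow> real"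
      using additive_tagged_division_1[OF \<open>a \<le> b\<close> p] .
    \<comment> \<open>Degenerate pieces are left out of \<open>q\<close>: they contribute nothing to the sums, and without them a
      piece is determined by its end points, which makes \<open>\<iota>\<close> injective.\<close>
    define q where "q = {(x, K) \<in> p. x \<in> N \<and> Inf K < Sup K}"
    define \<iota> where "\<iota> = (\<lambda>(x::real, K::real set). (Inf K, Sup K))"
    have "finite q" "q \<subseteq> p"
      unfolding q_def using pD(1) by (auto intro: rev_finite_subset)
    have disj: "{Inf K<..<Sup K} \<inter> {Inf K'<..<Sup K'} = {}"
      if "(x, K) \<in> q" "(x', K') \<in> q" "(x, K) \<noteq> (x', K')" for x K x' K'
      using pD(5)[of x K x' K'] that interval[of x K] interval[of x' K'] \<open>q \<subseteq> p\<close>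
      by (metis interior_atLeastAtMost_real subsetD)
    have inj: "inj_on \<iota> q"
    proof (rule inj_onI, clarify)
      fix x K x' K' assume *: "(x, K) \<in> q" "(x', K') \<in> q" "\<iota> (x, K) = \<iota> (x', K')"
      then have "{Inf K<..<Sup K} \<inter> {Inf K'<..<Sup K'} \<noteq> {}"
        unfolding q_def \<iota>_def using dense by fastforce
      then show "x = x' \<and> K = K'"
        using disj *(1,2) by blast
    qed
    have disj_fam: "disjoint_family_on (\<lambda>(v, w). {v<..<w}) (\<iota> ` q)"
      unfolding disjoint_family_on_def \<iota>_def using disj by fastforce
    have in_U: "(case z of (v, w) \<Rightarrow> {v<..<w}) \<subseteq> U" if z_in: "z \<in> \<iota> ` q" for z
    proof -
      obtain x K where z: "z = (Inf K, Sup K)" "(x, K) \<in> q"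
        using z_in unfolding \<iota>_def by auto
      have "{Inf K<..<Sup K} \<subseteq> K"
        using interval[of x K] z(2) \<open>q \<subseteq> p\<close> by (metis greaterThanLessThan_subseteq_atLeastAtMost_iff order_refl subsetD)
      moreover have "K \<subseteq> U"
        using interval[of x K] r_N[of x] z(2) unfolding q_def by blast
      ultimately show ?thesis
        using z by auto
    qed
    have "(\<Sum>(v, w)\<in>\<iota> ` q. w - v) = (\<Sum>z\<in>\<iota> ` q. measure lebesgue (case z of (v, w) \<Rightarrow> {v<..<w}))"
      by (intro sum.cong) (auto simp: \<iota>_def q_def)
    also have "\<dots> = measure lebesgue (\<Union>z\<in>\<iota> ` q. case z of (v, w) \<Rightarrow> {v<..<w})"
      by (rule measure_finite_Union[symmetric]) (use \<open>finite q\<close> disj_fam in \<open>auto simp: \<iota>_def q_def\<close>)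
    also have "\<dots> \<le> measure lebesgue U"
    proof (rule measure_mono_fmeasurable)
      show "(\<Union>z\<in>\<iota> ` q. case z of (v, w) \<Rightarrow> {v<..<w}) \<subseteq> U"
        by (intro UN_least in_U)
      show "(\<Union>z\<in>\<iota> ` q. case z of (v, w) \<Rightarrow> {v<..<w}) \<in> sets lebesgue"
        using \<open>finite q\<close> by (intro sets.finite_UN) (auto simp: \<iota>_def)
    qed (rule U_meas)
    finally have "(\<Sum>(v, w)\<in>\<iota> ` q. w - v) < \<delta>"
      using U_small by linarith
    moreover have "\<forall>(v, w)\<in>\<iota> ` q. v \<le> w \<and> {v..w} \<subseteq> {a..b}"
      using interval \<open>q \<subseteq> p\<close> by (fastforce simp: \<iota>_def q_def)
    ultimately have "(\<Sum>(v, w)\<in>\<iota> ` q. norm (u w - u v)) < \<epsilon>"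
      using \<delta>[OF _ _ disj_fam] \<open>finite q\<close> by blast
    then have q_small: "(\<Sum>(x, K)\<in>q. \<bar>u (Sup K) - u (Inf K)\<bar>) < \<epsilon>"
      unfolding sum.reindex[OF inj] by (simp add: \<iota>_def case_prod_unfold)
    have "u b - u a = (\<Sum>(x, K)\<in>p. u (Sup K) - u (Inf K))"
      using tele by simp
    also have "\<dots> \<le> (\<Sum>(x, K)\<in>p. \<epsilon> * (Sup K - Inf K) + (if (x, K) \<in> q then \<bar>u (Sup K) - u (Inf K)\<bar> else 0))"
    proof (intro sum_mono, clarify)
      fix x K assume xK: "(x, K) \<in> p"
      have "x \<in> {a..b}" "Inf K \<in> {a..b}" "Sup K \<in> {a..b}" "Inf K \<in> ball x (r x)" "Sup K \<in> ball x (r x)"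
        using interval[OF xK] by (metis atLeastAtMost_iff order_refl order_trans subsetD)+
      note bounds = this
      have ord: "Inf K \<le> x" "x \<le> Sup K"
        using interval[OF xK] by blast+
      have length: "0 \<le> \<epsilon> * (Sup K - Inf K)"
        using ord \<open>\<epsilon> > 0\<close> by simp
      show "u (Sup K) - u (Inf K) \<le> \<epsilon> * (Sup K - Inf K)
          + (if (x, K) \<in> q then \<bar>u (Sup K) - u (Inf K)\<bar> else 0)"
      proof (cases "x \<in> N")
        case True
        show ?thesis
        proof (cases "Inf K < Sup K")
          case True
          then have "(x, K) \<in> q"
            using xK \<open>x \<in> N\<close> unfolding q_def by blast
          then show ?thesis
            using length by simp
        next
          case False
          then have "Inf K = Sup K"
            using ord by linarith
          then show ?thesis
            by simp
        qed
      next
        case False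
        then have "u (Sup K) - u x \<le> \<epsilon> * (Sup K - x)" "u x - u (Inf K) \<le> \<epsilon> * (x - Inf K)"
          using r_off_N[of x] bounds ord by blast+
        moreover have "\<epsilon> * (Sup K - Inf K) = \<epsilon> * (Sup K - x) + \<epsilon> * (x - Inf K)"
          by (simp add: algebra_simps)
        ultimately have "u (Sup K) - u (Inf K) \<le> \<epsilon> * (Sup K - Inf K)"
          by linarith
        moreover have "0 \<le> (if (x, K) \<in> q then \<bar>u (Sup K) - u (Inf K)\<bar> else 0)"
          by simp
        ultimately show ?thesis
          by linarith
      qed
    qed
    also have "\<dots> = \<epsilon> * (\<Sum>(x, K)\<in>p. Sup K - Inf K) + (\<Sum>(x, K)\<in>q. \<bar>u (Sup K) - u (Inf K)\<bar>)"
    proof -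
      have "(\<Sum>(x, K)\<in>p. if (x, K) \<in> q then \<bar>u (Sup K) - u (Inf K)\<bar> else 0)
          = (\<Sum>z\<in>p. if z \<in> q then (case z of (x, K) \<Rightarrow> \<bar>u (Sup K) - u (Inf K)\<bar>) else 0)"
        by (intro sum.cong) auto
      also have "\<dots> = (\<Sum>(x, K)\<in>p \<inter> q. \<bar>u (Sup K) - u (Inf K)\<bar>)"
        using pD(1) by (rule sum.inter_restrict[symmetric])
      also have "p \<inter> q = q"
        using \<open>q \<subseteq> p\<close> by blast
      finally show ?thesis
        by (simp add: case_prod_unfold sum.distrib sum_distrib_left)
    qed
    also have "(\<Sum>(x, K)\<in>p. Sup K - Inf K) = b - a"
      using tele[of "\<lambda>t. t"] .
    finally show ?thesis
      using q_small by linarith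
  qed
  show ?thesis
  proof (rule field_le_epsilon)
    fix e :: real assume "e > 0"
    have "u b - u a \<le> e / (b - a + 1) * (b - a) + e / (b - a + 1)"
      using almost[of "e / (b - a + 1)"] \<open>e > 0\<close> \<open>a \<le> b\<close> by simp
    also have "\<dots> = e / (b - a + 1) * (b - a + 1)"
      by (simp only: distrib_left mult_1_right)
    also have "\<dots> = e"
      using \<open>a \<le> b\<close> by simp
    finally show "u b \<le> u a + e"
      by simp
  qed
qed

text \<open>Closure of absolute continuity under differences is the case \<open>C = 1\<close>; for inner products \<open>C\<close> is a
  common bound of both factors.\<close>

lemma abs_continuous_on_dominated:
  assumes g: "abs_continuous_on S g" and h: "abs_continuous_on S h" and "C \<ge> 0"
    and dom: "\<And>s t. s \<in> S \<Longrightarrow> t \<in> S \<Longrightarrow> norm (f t - f s) \<le> C * (norm (g t - g s) + norm (h t - h s))"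
  shows "abs_continuous_on S f"
  unfolding abs_continuous_on_def
proof (intro allI impI)
  fix \<epsilon> :: real assume "\<epsilon> > 0"
  define \<eta> where "\<eta> = \<epsilon> / (C + 1) / 2"
  have "\<eta> > 0"
    unfolding \<eta>_def using \<open>\<epsilon> > 0\<close> \<open>C \<ge> 0\<close> by simp
  obtain \<delta>1 where "\<delta>1 > 0" and
    \<delta>1: "\<And>P. finite P \<and> (\<forall>(u, v)\<in>P. u \<le> v \<and> {u..v} \<subseteq> S) \<and>
      disjoint_family_on (\<lambda>(u, v). {u<..<v}) P \<and> (\<Sum>(u, v)\<in>P. v - u) < \<delta>1 \<Longrightarrow>
      (\<Sum>(u, v)\<in>P. norm (g v - g u)) < \<eta>"
    using g \<open>\<eta> > 0\<close> unfolding abs_continuous_on_def by meson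
  obtain \<delta>2 where "\<delta>2 > 0" and
    \<delta>2: "\<And>P. finite P \<and> (\<forall>(u, v)\<in>P. u \<le> v \<and> {u..v} \<subseteq> S) \<and>
      disjoint_family_on (\<lambda>(u, v). {u<..<v}) P \<and> (\<Sum>(u, v)\<in>P. v - u) < \<delta>2 \<Longrightarrow>
      (\<Sum>(u, v)\<in>P. norm (h v - h u)) < \<eta>"
    using h \<open>\<eta> > 0\<close> unfolding abs_continuous_on_def by meson
  show "\<exists>\<delta>>0. \<forall>P. finite P \<and> (\<forall>(u, v)\<in>P. u \<le> v \<and> {u..v} \<subseteq> S) \<and>
      disjoint_family_on (\<lambda>(u, v). {u<..<v}) P \<and> (\<Sum>(u, v)\<in>P. v - u) < \<delta> \<longrightarrow>
      (\<Sum>(u, v)\<in>P. norm (f v - f u)) < \<epsilon>"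
  proof (intro exI[of _ "min \<delta>1 \<delta>2"] conjI allI impI)
    fix P
    assume P: "finite P \<and> (\<forall>(u, v)\<in>P. u \<le> v \<and> {u..v} \<subseteq> S) \<and>
      disjoint_family_on (\<lambda>(u, v). {u<..<v}) P \<and> (\<Sum>(u, v)\<in>P. v - u) < min \<delta>1 \<delta>2"
    have "(\<Sum>(u, v)\<in>P. norm (f v - f u)) \<le> (\<Sum>(u, v)\<in>P. C * (norm (g v - g u) + norm (h v - h u)))"
    proof (intro sum_mono, clarify)
      fix u v assume "(u, v) \<in> P"
      then have "u \<in> S" "v \<in> S"
        using P by fastforce+
      then show "norm (f v - f u) \<le> C * (norm (g v - g u) + norm (h v - h u))"
        by (rule dom)
    qed
    also have "\<dots> = C * ((\<Sum>(u, v)\<in>P. norm (g v - g u)) + (\<Sum>(u, v)\<in>P. norm (h v - h u)))"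
      by (simp add: case_prod_unfold sum.distrib sum_distrib_left distrib_left)
    also have "\<dots> \<le> C * (\<eta> + \<eta>)"
      using \<delta>1[of P] \<delta>2[of P] P \<open>C \<ge> 0\<close> by (intro mult_left_mono) auto
    also have "\<dots> < (C + 1) * (\<eta> + \<eta>)"
      using \<open>\<eta> > 0\<close> by simp
    also have "\<dots> = \<epsilon>"
      unfolding \<eta>_def field_sum_of_halves using \<open>C \<ge> 0\<close> by simp
    finally show "(\<Sum>(u, v)\<in>P. norm (f v - f u)) < \<epsilon>" .
  qed (use \<open>\<delta>1 > 0\<close> \<open>\<delta>2 > 0\<close> in simp)
qed

lemma abs_continuous_on_id: "abs_continuous_on S (\<lambda>t. t)"
  unfolding abs_continuous_on_def
proof (intro allI impI)
  fix \<epsilon> :: real assume "\<epsilon> > 0"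
  show "\<exists>\<delta>>0. \<forall>P. finite P \<and> (\<forall>(u, v)\<in>P. u \<le> v \<and> {u..v} \<subseteq> S) \<and>
      disjoint_family_on (\<lambda>(u, v). {u<..<v}) P \<and> (\<Sum>(u, v)\<in>P. v - u) < \<delta> \<longrightarrow>
      (\<Sum>(u, v)\<in>P. norm (v - u)) < \<epsilon>"
  proof (intro exI[of _ \<epsilon>] conjI allI impI)
    fix P
    assume P: "finite P \<and> (\<forall>(u, v)\<in>P. u \<le> v \<and> {u..v} \<subseteq> S) \<and>
      disjoint_family_on (\<lambda>(u, v). {u<..<v}) P \<and> (\<Sum>(u, v)\<in>P. v - u) < \<epsilon>"
    then have "(\<Sum>(u, v)\<in>P. norm (v - u)) = (\<Sum>(u, v)\<in>P. v - u)"
      by (intro sum.cong) auto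
    then show "(\<Sum>(u, v)\<in>P. norm (v - u)) < \<epsilon>"
      using P by simp
  qed (rule \<open>\<epsilon> > 0\<close>)
qed

lemma abs_continuous_on_const: "abs_continuous_on S (\<lambda>t. c)"
  by (rule abs_continuous_on_dominated[OF abs_continuous_on_id abs_continuous_on_id, of 0]) auto

lemma abs_continuous_on_diff:
  assumes "abs_continuous_on S g" "abs_continuous_on S h"
  shows "abs_continuous_on S (\<lambda>t. g t - h t)"
proof (rule abs_continuous_on_dominated[OF assms, of 1])
  fix s t
  have "(g t - h t) - (g s - h s) = (g t - g s) - (h t - h s)"
    by simp
  then show "norm ((g t - h t) - (g s - h s)) \<le> 1 * (norm (g t - g s) + norm (h t - h s))"
    by (metis mult_1 norm_triangle_ineq4)
qed simp

lemma abs_continuous_on_shift: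
  assumes "abs_continuous_on {s + a..s + b} g"
  shows "abs_continuous_on {a..b} (\<lambda>t. g (s + t))"
  unfolding abs_continuous_on_def
proof (intro allI impI)
  fix \<epsilon> :: real assume "\<epsilon> > 0"
  then obtain \<delta> where "\<delta> > 0" and
    \<delta>: "\<And>P. finite P \<and> (\<forall>(u, v)\<in>P. u \<le> v \<and> {u..v} \<subseteq> {s + a..s + b}) \<and>
      disjoint_family_on (\<lambda>(u, v). {u<..<v}) P \<and> (\<Sum>(u, v)\<in>P. v - u) < \<delta> \<Longrightarrow>
      (\<Sum>(u, v)\<in>P. norm (g v - g u)) < \<epsilon>"
    using assms unfolding abs_continuous_on_def by meson
  show "\<exists>\<delta>>0. \<forall>P. finite P \<and> (\<forall>(u, v)\<in>P. u \<le> v \<and> {u..v} \<subseteq> {a..b}) \<and>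
      disjoint_family_on (\<lambda>(u, v). {u<..<v}) P \<and> (\<Sum>(u, v)\<in>P. v - u) < \<delta> \<longrightarrow>
      (\<Sum>(u, v)\<in>P. norm (g (s + v) - g (s + u))) < \<epsilon>"
  proof (intro exI[of _ \<delta>] conjI allI impI)
    fix P
    assume P: "finite P \<and> (\<forall>(u, v)\<in>P. u \<le> v \<and> {u..v} \<subseteq> {a..b}) \<and>
      disjoint_family_on (\<lambda>(u, v). {u<..<v}) P \<and> (\<Sum>(u, v)\<in>P. v - u) < \<delta>"
    define \<tau> where "\<tau> = (\<lambda>(u, v). (s + u, s + v))"
    have inj: "inj_on \<tau> P"
      unfolding \<tau>_def by (auto simp: inj_on_def)
    have "disjoint_family_on (\<lambda>(u, v). {u<..<v}) (\<tau> ` P)"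
      unfolding disjoint_family_on_def
    proof (intro ballI impI)
      fix y z assume "y \<in> \<tau> ` P" "z \<in> \<tau> ` P" "y \<noteq> z"
      then obtain u v u' v' where *: "(u, v) \<in> P" "(u', v') \<in> P" "(u, v) \<noteq> (u', v')"
        "y = (s + u, s + v)" "z = (s + u', s + v')"
        unfolding \<tau>_def by auto
      then have "{u<..<v} \<inter> {u'<..<v'} = {}"
        using P unfolding disjoint_family_on_def by fastforce
      then have "{s + u<..<s + v} \<inter> {s + u'<..<s + v'} = {}"
        by auto
      then show "(case y of (u, v) \<Rightarrow> {u<..<v}) \<inter> (case z of (u, v) \<Rightarrow> {u<..<v}) = {}"
        using * by (simp only: case_prod_conv)
    qed
    moreover have "(\<Sum>(u, v)\<in>\<tau> ` P. v - u) = (\<Sum>(u, v)\<in>P. v - u)"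
      unfolding sum.reindex[OF inj] by (simp add: case_prod_unfold \<tau>_def)
    moreover have "\<forall>(u, v)\<in>\<tau> ` P. u \<le> v \<and> {u..v} \<subseteq> {s + a..s + b}"
      using P by (fastforce simp: \<tau>_def)
    ultimately have "(\<Sum>(u, v)\<in>\<tau> ` P. norm (g v - g u)) < \<epsilon>"
      using P by (intro \<delta>) simp
    then show "(\<Sum>(u, v)\<in>P. norm (g (s + v) - g (s + u))) < \<epsilon>"
      unfolding sum.reindex[OF inj] by (simp add: case_prod_unfold \<tau>_def)
  qed (rule \<open>\<delta> > 0\<close>)
qed

lemma abs_continuous_on_imp_continuous_on:
  assumes "abs_continuous_on {a..b} g"
  shows "continuous_on {a..b} g"
  unfolding continuous_on_iff
proof (intro ballI allI impI)
  fix s \<epsilon> :: real assume "s \<in> {a..b}" "\<epsilon> > 0"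
  then obtain \<delta> where "\<delta> > 0" and
    \<delta>: "\<And>P. finite P \<Longrightarrow> (\<forall>(u, v)\<in>P. u \<le> v \<and> {u..v} \<subseteq> {a..b}) \<Longrightarrow>
      disjoint_family_on (\<lambda>(u, v). {u<..<v}) P \<Longrightarrow> (\<Sum>(u, v)\<in>P. v - u) < \<delta> \<Longrightarrow>
      (\<Sum>(u, v)\<in>P. norm (g v - g u)) < \<epsilon>"
    using assms unfolding abs_continuous_on_def by meson
  have "dist (g t) (g s) < \<epsilon>" if "t \<in> {a..b}" "dist t s < \<delta>" for t
    using \<delta>[of "{(min s t, max s t)}"] that \<open>s \<in> {a..b}\<close>
    by (cases "s \<le> t") (auto simp: disjoint_family_on_def dist_norm norm_minus_commute)
  then show "\<exists>\<delta>>0. \<forall>t\<in>{a..b}. dist t s < \<delta> \<longrightarrow> dist (g t) (g s) < \<epsilon>"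
    using \<open>\<delta> > 0\<close> by blast
qed

lemma abs_continuous_on_inner:
  fixes g h :: "real \<Rightarrow> 'a::real_inner"
  assumes g: "abs_continuous_on {a..b} g" and h: "abs_continuous_on {a..b} h"
  shows "abs_continuous_on {a..b} (\<lambda>t. g t \<bullet> h t)"
proof -
  have "bounded (g ` {a..b})" "bounded (h ` {a..b})"
    using g h by (auto intro!: compact_imp_bounded compact_continuous_image
        abs_continuous_on_imp_continuous_on)
  then obtain A B where "\<forall>v\<in>g ` {a..b}. norm v \<le> A" "\<forall>v\<in>h ` {a..b}. norm v \<le> B"
    unfolding bounded_iff by blast
  then have A: "norm (g t) \<le> A" and B: "norm (h t) \<le> B" if "t \<in> {a..b}" for t
    using that by blast+
  show ?thesis
  proof (rule abs_continuous_on_dominated[OF g h, of "max 0 (max A B)"])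
    fix s t assume st: "s \<in> {a..b}" "t \<in> {a..b}"
    have "g t \<bullet> h t - g s \<bullet> h s = (g t - g s) \<bullet> h t + g s \<bullet> (h t - h s)"
      by (simp add: inner_diff_left inner_diff_right)
    also have "norm \<dots> \<le> norm (g t - g s) * norm (h t) + norm (g s) * norm (h t - h s)"
      by (metis norm_triangle_le add_mono Cauchy_Schwarz_ineq2 real_norm_def)
    also have "\<dots> \<le> norm (g t - g s) * max 0 (max A B) + max 0 (max A B) * norm (h t - h s)"
      using A[of s] B[of t] st by (intro add_mono mult_mono) auto
    finally show "norm (g t \<bullet> h t - g s \<bullet> h s)
        \<le> max 0 (max A B) * (norm (g t - g s) + norm (h t - h s))"
      by (simp add: algebra_simps)
  qed simp
qed

text \<open>The scalar function \<open>t \<mapsto> |u t|\<^sup>2 + 2 c t\<close> is absolutely continuous with nonpositive derivative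
  \<open>2 (u \<bullet> u' + c)\<close>.\<close>

lemma norm_square_decrease:
  fixes u :: "real \<Rightarrow> 'a::real_inner"
  assumes ac: "abs_continuous_on {a..b} u" and "a \<le> b"
    and deriv: "AE t in lebesgue. t \<in> {a..b} \<longrightarrow>
      (\<exists>d. (u has_vector_derivative d) (at t within {a..b}) \<and> u t \<bullet> d \<le> - c)"
  shows "(norm (u b))\<^sup>2 \<le> (norm (u a))\<^sup>2 - 2 * c * (b - a)"
proof -
  define f where "f = (\<lambda>t. u t \<bullet> u t - (- 2 * c) * t)"
  have "abs_continuous_on {a..b} (\<lambda>t. (- 2 * c) \<bullet> t)"
    by (intro abs_continuous_on_inner abs_continuous_on_const abs_continuous_on_id)
  then have "abs_continuous_on {a..b} f"
    unfolding f_def by (intro abs_continuous_on_diff abs_continuous_on_inner ac) (simp add: inner_real_def)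
  moreover have "AE t in lebesgue. t \<in> {a..b} \<longrightarrow>
      (\<exists>d\<le>0. (f has_vector_derivative d) (at t within {a..b}))"
    using deriv
  proof eventually_elim
    case (elim t)
    show ?case
    proof
      assume "t \<in> {a..b}"
      then obtain d where d: "(u has_vector_derivative d) (at t within {a..b})" "u t \<bullet> d \<le> - c"
        using elim by blast
      have "(f has_vector_derivative (2 * (u t \<bullet> d) + 2 * c)) (at t within {a..b})"
        using d(1) unfolding f_def has_vector_derivative_def
        by (auto intro!: derivative_eq_intros simp: inner_commute algebra_simps)
      then show "\<exists>d\<le>0. (f has_vector_derivative d) (at t within {a..b})"
        using d(2) by (intro exI[of _ "2 * (u t \<bullet> d) + 2 * c"]) auto
    qed
  qed
  ultimately have "f b \<le> f a"
    using abs_continuous_on_nonincreasing \<open>a \<le> b\<close> by blast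
  then show ?thesis
    unfolding f_def by (simp add: power2_norm_eq_inner algebra_simps)
qed

text \<open>Mean value inequality: project onto the direction \<open>e = u b - u a\<close>, so that
  \<open>t \<mapsto> u t \<bullet> e - L |e| t\<close> is nonincreasing.\<close>

lemma norm_increment_le:
  fixes u :: "real \<Rightarrow> 'a::real_inner"
  assumes ac: "abs_continuous_on {a..b} u" and "a \<le> b" and "0 \<le> L"
    and deriv: "AE t in lebesgue. t \<in> {a..b} \<longrightarrow>
      (\<exists>d. (u has_vector_derivative d) (at t within {a..b}) \<and> norm d \<le> L)"
  shows "norm (u b - u a) \<le> L * (b - a)"
proof -
  define e where "e = u b - u a"
  define f where "f = (\<lambda>t. u t \<bullet> e - (L * norm e) * t)"
  have "abs_continuous_on {a..b} (\<lambda>t. (L * norm e) \<bullet> t)"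
    by (intro abs_continuous_on_inner abs_continuous_on_const abs_continuous_on_id)
  then have "abs_continuous_on {a..b} f"
    unfolding f_def
    by (intro abs_continuous_on_diff abs_continuous_on_inner ac abs_continuous_on_const)
      (simp add: inner_real_def)
  moreover have "AE t in lebesgue. t \<in> {a..b} \<longrightarrow>
      (\<exists>d\<le>0. (f has_vector_derivative d) (at t within {a..b}))"
    using deriv
  proof eventually_elim
    case (elim t)
    show ?case
    proof
      assume "t \<in> {a..b}"
      then obtain d where d: "(u has_vector_derivative d) (at t within {a..b})" "norm d \<le> L"
        using elim by blast
      have "(f has_vector_derivative (d \<bullet> e - L * norm e)) (at t within {a..b})"
        using d(1) unfolding f_def has_vector_derivative_def
        by (auto intro!: derivative_eq_intros simp: algebra_simps)
      moreover have "d \<bullet> e \<le> L * norm e"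
        using norm_cauchy_schwarz[of d e] mult_right_mono[OF d(2) norm_ge_zero[of e]] by linarith
      ultimately show "\<exists>d\<le>0. (f has_vector_derivative d) (at t within {a..b})"
        by (intro exI[of _ "d \<bullet> e - L * norm e"]) auto
    qed
  qed
  ultimately have "f b \<le> f a"
    using abs_continuous_on_nonincreasing \<open>a \<le> b\<close> by blast
  then have "e \<bullet> e \<le> L * norm e * (b - a)"
    unfolding f_def e_def by (simp add: inner_diff_left algebra_simps)
  then have "norm e * norm e \<le> norm e * (L * (b - a))"
    by (simp add: power2_norm_eq_inner[symmetric] power2_eq_square algebra_simps)
  moreover have "0 \<le> L * (b - a)"
    using \<open>0 \<le> L\<close> \<open>a \<le> b\<close> by simp
  ultimately show ?thesis
    unfolding e_def[symmetric] by (cases "norm e = 0") auto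
qed

section \<open>Solutions of dissipative differential equations\<close>

lemma solution_on_interval:
  assumes "caratheodory_solution X D J g" "{a..b} \<subseteq> J"
  shows "abs_continuous_on {a..b} g"
    and "AE t in lebesgue. t \<in> {a..b} \<longrightarrow> g t \<in> D \<and> (g has_vector_derivative X (g t)) (at t within {a..b})"
proof -
  show "abs_continuous_on {a..b} g"
    using assms unfolding caratheodory_solution_def by blast
  have "AE t in lebesgue. t \<in> J \<longrightarrow> (g has_vector_derivative X (g t)) (at t within J)" and "g ` J \<subseteq> D"
    using assms(1) unfolding caratheodory_solution_def by blast+
  from this(1) show "AE t in lebesgue. t \<in> {a..b} \<longrightarrow> g t \<in> D \<and>
      (g has_vector_derivative X (g t)) (at t within {a..b})"
  proof eventually_elim
    case (elim t)
    then show ?case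
      using assms(2) \<open>g ` J \<subseteq> D\<close> has_vector_derivative_within_subset by blast
  qed
qed

lemma solution_restrict:
  assumes "caratheodory_solution X D J g" "is_interval I" "0 \<in> I" "I \<subseteq> J"
  shows "caratheodory_solution X D I g"
proof -
  have ae: "AE t in lebesgue. t \<in> J \<longrightarrow> (g has_vector_derivative X (g t)) (at t within J)"
    using assms(1) unfolding caratheodory_solution_def by blast
  then have "AE t in lebesgue. t \<in> I \<longrightarrow> (g has_vector_derivative X (g t)) (at t within I)"
    using assms(4) by (auto elim!: eventually_mono intro: has_vector_derivative_within_subset)
  moreover have "abs_continuous_on {a..b} g" if "{a..b} \<subseteq> I" for a b
    using assms(1,4) that unfolding caratheodory_solution_def by blast
  moreover have "J \<subseteq> {0..}" "g ` J \<subseteq> D"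
    using assms(1) unfolding caratheodory_solution_def by blast+
  ultimately show ?thesis
    using assms(2-4) unfolding caratheodory_solution_def by blast
qed

lemma solution_shift:
  assumes sol: "caratheodory_solution X D {0..} g" and "s \<ge> 0"
  shows "caratheodory_solution X D {0..} (\<lambda>t. g (s + t))"
proof -
  have ac: "\<And>a b. {a..b} \<subseteq> {0..} \<Longrightarrow> abs_continuous_on {a..b} g" and range: "g ` {0..} \<subseteq> D"
    and ae: "AE t in lebesgue. t \<in> {0..} \<longrightarrow> (g has_vector_derivative X (g t)) (at t within {0..})"
    using sol unfolding caratheodory_solution_def by blast+
  obtain N where N: "negligible N"
    and deriv: "\<And>t. t \<ge> 0 \<Longrightarrow> t \<notin> N \<Longrightarrow> (g has_vector_derivative X (g t)) (at t within {0..})"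
    using ae unfolding eventually_ae_filter_negligible by (metis (mono_tags, lifting) atLeast_iff mem_Collect_eq subsetD)
  have "((\<lambda>t. g (s + t)) has_vector_derivative X (g (s + t))) (at t within {0..})"
    if "t \<ge> 0" "t \<notin> (+) (- s) ` N" for t
  proof -
    have "s + t \<notin> N"
    proof
      assume "s + t \<in> N"
      then have "- s + (s + t) \<in> (+) (- s) ` N"
        by (rule imageI)
      then show False
        using that(2) by simp
    qed
    then have "(g has_vector_derivative X (g (s + t))) (at (s + t) within {0..})"
      using deriv \<open>s \<ge> 0\<close> that(1) by simp
    then have g': "(g has_vector_derivative X (g (s + t))) (at (s + t) within (+) s ` {0..})"
      by (rule has_vector_derivative_within_subset) (use \<open>s \<ge> 0\<close> in auto)
    have "((+) s has_vector_derivative 1) (at t within {0..})"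
      by (auto intro!: derivative_eq_intros simp: has_vector_derivative_def)
    from vector_diff_chain_within[OF this g'] show ?thesis
      by (simp add: o_def)
  qed
  then have "AE t in lebesgue. t \<in> {0..} \<longrightarrow>
      ((\<lambda>t. g (s + t)) has_vector_derivative X (g (s + t))) (at t within {0..})"
    unfolding eventually_ae_filter_negligible
    by (intro exI[of _ "(+) (- s) ` N"] conjI negligible_translation N) auto
  moreover have "abs_continuous_on {a..b} (\<lambda>t. g (s + t))" if "{a..b} \<subseteq> {0..}" for a b
  proof (rule abs_continuous_on_shift, rule ac)
    show "{s + a..s + b} \<subseteq> {0..}"
      using that \<open>s \<ge> 0\<close> by (cases "a \<le> b") auto
  qed
  moreover have "(\<lambda>t. g (s + t)) ` {0..} \<subseteq> D"
    using range \<open>s \<ge> 0\<close> by (auto simp: image_subset_iff)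
  ultimately show ?thesis
    unfolding caratheodory_solution_def by (auto simp: is_interval_ci)
qed

lemma solution_const:
  assumes "is_interval J" "0 \<in> J" "J \<subseteq> {0..}" "w \<in> D" "X w = 0"
  shows "caratheodory_solution X D J (\<lambda>t. w)"
proof -
  have "AE t in lebesgue. t \<in> J \<longrightarrow> ((\<lambda>t. w) has_vector_derivative X w) (at t within J)"
    unfolding \<open>X w = 0\<close> by (intro AE_I2 impI has_vector_derivative_const)
  then show ?thesis
    using assms(1-4) abs_continuous_on_const unfolding caratheodory_solution_def by blast
qed

lemma interval_from_0:
  assumes "is_interval (J :: real set)" "0 \<in> J" "t \<in> J"
  shows "{0..t} \<subseteq> J"
  using mem_is_interval_1_I[OF assms] by auto

definition dissipative_on :: "'a::real_inner set \<Rightarrow> ('a \<Rightarrow> 'a) \<Rightarrow> bool" where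
  "dissipative_on D X \<longleftrightarrow> (\<forall>v\<in>D. \<forall>w\<in>D. (X v - X w) \<bullet> (v - w) \<le> 0)"

text \<open>Half the derivative of \<open>|g - h|\<^sup>2\<close> is \<open>(X g - X h) \<bullet> (g - h) \<le> 0\<close>.\<close>

lemma dissipative_contraction:
  assumes diss: "dissipative_on D X" and g: "caratheodory_solution X D J g"
    and h: "caratheodory_solution X D J h" and "t \<in> J"
  shows "dist (g t) (h t) \<le> dist (g 0) (h 0)"
proof -
  have "is_interval J" "0 \<in> J" "J \<subseteq> {0..}"
    using g unfolding caratheodory_solution_def by blast+
  then have sub: "{0..t} \<subseteq> J" and "0 \<le> t"
    using interval_from_0 \<open>t \<in> J\<close> by auto
  note g_int = solution_on_interval[OF g sub] and h_int = solution_on_interval[OF h sub]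
  have "AE s in lebesgue. s \<in> {0..t} \<longrightarrow>
      (\<exists>d. ((\<lambda>t. g t - h t) has_vector_derivative d) (at s within {0..t}) \<and> (g s - h s) \<bullet> d \<le> - 0)"
    using g_int(2) h_int(2)
  proof eventually_elim
    case (elim s)
    show ?case
    proof
      assume "s \<in> {0..t}"
      then have "((\<lambda>t. g t - h t) has_vector_derivative X (g s) - X (h s)) (at s within {0..t})"
        and "g s \<in> D" "h s \<in> D"
        using elim by (auto intro: has_vector_derivative_diff)
      moreover from this have "(g s - h s) \<bullet> (X (g s) - X (h s)) \<le> - 0"
        using diss unfolding dissipative_on_def by (simp add: inner_commute)
      ultimately show "\<exists>d. ((\<lambda>t. g t - h t) has_vector_derivative d) (at s within {0..t}) \<and>
          (g s - h s) \<bullet> d \<le> - 0"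
        by blast
    qed
  qed
  from norm_square_decrease[OF abs_continuous_on_diff[OF g_int(1) h_int(1)] \<open>0 \<le> t\<close> this]
  have "(norm (g t - h t))\<^sup>2 \<le> (norm (g 0 - h 0))\<^sup>2"
    by simp
  then show ?thesis
    by (simp add: dist_norm power2_le_iff_abs_le)
qed

lemma dissipative_equilibrium_stable:
  assumes diss: "dissipative_on D X" and "w \<in> D" "X w = 0"
  shows "lyapunov_stable X D w"
proof -
  have "dist (g t) w \<le> dist (g 0) w" if g: "caratheodory_solution X D J g" and "t \<in> J" for J g t
  proof -
    have "caratheodory_solution X D J (\<lambda>t. w)"
      using g assms(2,3) unfolding caratheodory_solution_def[of X D J g]
      by (intro solution_const) auto
    from dissipative_contraction[OF diss g this \<open>t \<in> J\<close>] show ?thesis .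
  qed
  then show ?thesis
    unfolding lyapunov_stable_def by (metis order_le_less_trans)
qed

text \<open>If \<open>g (\<tau> k) \<rightarrow> h 0\<close>, then contraction bounds the distance of \<open>g (\<tau> k + t)\<close> and \<open>h t\<close> by that of
  \<open>g (\<tau> k)\<close> and \<open>h 0\<close>; so \<open>h t\<close> is the limit of \<open>g\<close> along the shifted times.\<close>

lemma dissipative_omega_limit_invariant:
  assumes diss: "dissipative_on D X" and g: "caratheodory_solution X D {0..} g"
  shows "invariant_set X D (omega_limit_set g)"
  unfolding invariant_set_def
proof (intro allI impI ballI)
  fix J h t
  assume h: "caratheodory_solution X D J h \<and> h 0 \<in> omega_limit_set g" and "t \<in> J"
  then obtain \<tau> where \<tau>: "filterlim \<tau> at_top sequentially" "(\<lambda>k::nat. g (\<tau> k)) \<longlonglongrightarrow> h 0"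
    unfolding omega_limit_set_def by blast
  have J: "is_interval J" "0 \<in> J" "J \<subseteq> {0..}"
    using h unfolding caratheodory_solution_def by blast+
  have close: "dist (g (\<tau> k + t)) (h t) \<le> dist (g (\<tau> k)) (h 0)" if "\<tau> k \<ge> 0" for k
  proof -
    have "caratheodory_solution X D J (\<lambda>t. g (\<tau> k + t))"
      using solution_restrict[OF solution_shift[OF g that]] J by blast
    from dissipative_contraction[OF diss this _ \<open>t \<in> J\<close>, of h] h show ?thesis
      by simp
  qed
  have "\<forall>\<^sub>F k in sequentially. \<tau> k \<ge> 0"
    using \<tau>(1) unfolding filterlim_at_top by blast
  then have "\<forall>\<^sub>F k in sequentially. norm (dist (g (\<tau> k + t)) (h t)) \<le> dist (g (\<tau> k)) (h 0)"
    by eventually_elim (simp add: close)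
  moreover have "(\<lambda>k. dist (g (\<tau> k)) (h 0)) \<longlonglongrightarrow> 0"
    using \<tau>(2) by (simp add: tendsto_dist_iff[symmetric])
  ultimately have "(\<lambda>k. g (\<tau> k + t)) \<longlonglongrightarrow> h t"
    by (subst tendsto_dist_iff) (rule Lim_null_comparison)
  moreover have "filterlim (\<lambda>k. \<tau> k + t) at_top sequentially"
    using filterlim_tendsto_add_at_top[OF tendsto_const \<tau>(1), of t] by (simp add: add.commute)
  ultimately show "h t \<in> omega_limit_set g"
    unfolding omega_limit_set_def by blast
qed

text \<open>A version of Barbalat's lemma. Suppose \<open>\<phi> w > 0\<close>. Then \<open>\<phi> \<ge> c > 0\<close> on a ball around \<open>w\<close>. The
  solution is Lipschitz in time, so after each visit close to \<open>w\<close> it spends a fixed time \<open>\<sigma>\<close> in this ball,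
  during which the squared distance \<open>V\<close> to \<open>e\<close> drops by \<open>2 c \<sigma>\<close>. Late visits start with \<open>V\<close> within
  \<open>2 c \<sigma>\<close> of its limit, which is a lower bound of \<open>V\<close>: a contradiction.\<close>

lemma omega_limit_no_dissipation:
  fixes g :: "real \<Rightarrow> 'a::euclidean_space"
  assumes g: "caratheodory_solution X D {0..} g" and "closed D"
    and cont: "continuous_on D \<phi>" and nonneg: "\<And>v. v \<in> D \<Longrightarrow> \<phi> v \<ge> 0"
    and diss: "\<And>v. v \<in> D \<Longrightarrow> X v \<bullet> (v - e) \<le> - \<phi> v"
    and bdd: "\<And>B. B \<subseteq> D \<Longrightarrow> bounded B \<Longrightarrow> bounded (X ` B)"
    and w: "w \<in> omega_limit_set g"
  shows "w \<in> D" and "\<phi> w = (0::real)"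
proof -
  obtain \<tau> where \<tau>: "filterlim \<tau> at_top sequentially" "(\<lambda>k::nat. g (\<tau> k)) \<longlonglongrightarrow> w"
    using w unfolding omega_limit_set_def by blast
  have range: "g t \<in> D" if "t \<ge> 0" for t
    using g that unfolding caratheodory_solution_def by auto
  have \<tau>_nonneg: "\<forall>\<^sub>F k in sequentially. \<tau> k \<ge> 0"
    using \<tau>(1) unfolding filterlim_at_top by blast
  show "w \<in> D"
  proof (rule Lim_in_closed_set[OF \<open>closed D\<close> _ _ \<tau>(2)])
    show "\<forall>\<^sub>F k in sequentially. g (\<tau> k) \<in> D"
      using \<tau>_nonneg by eventually_elim (rule range)
  qed simp
  define V where "V = (\<lambda>t. (norm (g t - e))\<^sup>2)"
  have V_decrease: "V b \<le> V a - 2 * c * (b - a)"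
    if "0 \<le> a" "a \<le> b" and c: "\<And>t. t \<in> {a..b} \<Longrightarrow> c \<le> \<phi> (g t)" for a b c
  proof -
    have "{a..b} \<subseteq> {0..}"
      using that by auto
    note g_int = solution_on_interval[OF g this]
    have "AE t in lebesgue. t \<in> {a..b} \<longrightarrow>
        (\<exists>d. ((\<lambda>t. g t - e) has_vector_derivative d) (at t within {a..b}) \<and> (g t - e) \<bullet> d \<le> - c)"
      using g_int(2)
    proof eventually_elim
      case (elim t)
      show ?case
      proof
        assume t: "t \<in> {a..b}"
        then have "((\<lambda>t. g t - e) has_vector_derivative X (g t) - 0) (at t within {a..b})"
          using elim by (intro has_vector_derivative_diff has_vector_derivative_const) auto
        moreover have "(g t - e) \<bullet> (X (g t) - 0) \<le> - c"
          using diss[of "g t"] c[OF t] elim t by (simp add: inner_commute)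
        ultimately show "\<exists>d. ((\<lambda>t. g t - e) has_vector_derivative d) (at t within {a..b}) \<and>
            (g t - e) \<bullet> d \<le> - c"
          by blast
      qed
    qed
    from norm_square_decrease[OF abs_continuous_on_diff[OF g_int(1) abs_continuous_on_const] \<open>a \<le> b\<close> this]
    show ?thesis
      unfolding V_def .
  qed
  have V_mono: "V b \<le> V a" if "0 \<le> a" "a \<le> b" for a b
    using V_decrease[OF that, of 0] nonneg range that by auto
  define V_inf where "V_inf = (norm (w - e))\<^sup>2"
  have V_lim: "(\<lambda>k. V (\<tau> k)) \<longlonglongrightarrow> V_inf"
    unfolding V_def V_inf_def by (intro tendsto_power tendsto_norm tendsto_diff tendsto_const \<tau>(2))
  have V_lower: "V_inf \<le> V t" if "t \<ge> 0" for t
  proof (rule tendsto_upperbound[OF V_lim])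
    have "\<forall>\<^sub>F k in sequentially. \<tau> k \<ge> t"
      using \<tau>(1) unfolding filterlim_at_top by blast
    then show "\<forall>\<^sub>F k in sequentially. V (\<tau> k) \<le> V t"
      by eventually_elim (use V_mono that in blast)
  qed simp
  have "norm (g t - e) \<le> norm (g 0 - e)" if "t \<ge> 0" for t
    using V_mono[OF order_refl that] unfolding V_def by (simp add: power2_le_iff_abs_le)
  then have "bounded ((\<lambda>t. g t) ` {0..})"
    unfolding bounded_any_center[of _ e] by (intro exI[of _ "norm (g 0 - e)"]) (auto simp: dist_norm norm_minus_commute)
  then have "bounded (X ` g ` {0..})"
    using range by (intro bdd) auto
  then obtain L where "L > 0" and L: "\<And>t. t \<ge> 0 \<Longrightarrow> norm (X (g t)) \<le> L"
    unfolding bounded_pos by auto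
  have lip: "norm (g b - g a) \<le> L * (b - a)" if "0 \<le> a" "a \<le> b" for a b
  proof -
    have "{a..b} \<subseteq> {0..}"
      using that by auto
    note g_int = solution_on_interval[OF g this]
    show ?thesis
    proof (rule norm_increment_le[OF g_int(1) \<open>a \<le> b\<close>])
      show "AE t in lebesgue. t \<in> {a..b} \<longrightarrow>
          (\<exists>d. (g has_vector_derivative d) (at t within {a..b}) \<and> norm d \<le> L)"
        using g_int(2) by eventually_elim (use L that in auto)
    qed (use \<open>L > 0\<close> in simp)
  qed
  show "\<phi> w = 0"
  proof (rule ccontr)
    assume "\<phi> w \<noteq> 0"
    define c where "c = \<phi> w / 2"
    have "c > 0"
      unfolding c_def using nonneg[OF \<open>w \<in> D\<close>] \<open>\<phi> w \<noteq> 0\<close> by simp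
    obtain r where "r > 0" and r: "\<And>v. v \<in> D \<Longrightarrow> dist v w < r \<Longrightarrow> dist (\<phi> v) (\<phi> w) < c"
      using cont \<open>w \<in> D\<close> \<open>c > 0\<close> unfolding continuous_on_iff by metis
    have \<phi>_ge: "c \<le> \<phi> v" if "v \<in> D" "dist v w < r" for v
      using r[OF that] unfolding c_def dist_real_def by (simp add: abs_if split: if_splits)
    define \<sigma> where "\<sigma> = r / (2 * L)"
    have "\<sigma> > 0"
      unfolding \<sigma>_def using \<open>r > 0\<close> \<open>L > 0\<close> by simp
    have "\<forall>\<^sub>F k in sequentially. dist (g (\<tau> k)) w < r / 2"
      using tendstoD[OF \<tau>(2), of "r / 2"] \<open>r > 0\<close> by simp
    moreover have "\<forall>\<^sub>F k in sequentially. V (\<tau> k) < V_inf + 2 * c * \<sigma>"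
      using order_tendstoD(2)[OF V_lim] \<open>c > 0\<close> \<open>\<sigma> > 0\<close> by simp
    ultimately have "\<forall>\<^sub>F k in sequentially. dist (g (\<tau> k)) w < r / 2 \<and> V (\<tau> k) < V_inf + 2 * c * \<sigma> \<and> \<tau> k \<ge> 0"
      using \<tau>_nonneg by eventually_elim blast
    then obtain k where k: "dist (g (\<tau> k)) w < r / 2" "V (\<tau> k) < V_inf + 2 * c * \<sigma>" "\<tau> k \<ge> 0"
      unfolding eventually_sequentially by blast
    have "c \<le> \<phi> (g t)" if "t \<in> {\<tau> k..\<tau> k + \<sigma>}" for t
    proof (rule \<phi>_ge)
      show "g t \<in> D"
        using range k(3) that by simp
      have "dist (g t) (g (\<tau> k)) \<le> L * (t - \<tau> k)"
        using lip[of "\<tau> k" t] k(3) that by (simp add: dist_norm)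
      also have "\<dots> \<le> L * \<sigma>"
        using that \<open>L > 0\<close> by (intro mult_left_mono) auto
      also have "\<dots> = r / 2"
        unfolding \<sigma>_def using \<open>L > 0\<close> by simp
      finally show "dist (g t) w < r"
        using k(1) dist_triangle[of "g t" w "g (\<tau> k)"] by linarith
    qed
    then have "V (\<tau> k + \<sigma>) \<le> V (\<tau> k) - 2 * c * (\<tau> k + \<sigma> - \<tau> k)"
      using V_decrease[of "\<tau> k" "\<tau> k + \<sigma>" c] k(3) \<open>\<sigma> > 0\<close> by simp
    moreover have "V_inf \<le> V (\<tau> k + \<sigma>)"
      using V_lower k(3) \<open>\<sigma> > 0\<close> by simp
    ultimately show False
      using k(2) by simp
  qed
qed

section \<open>Derivatives within a set\<close>

lemma has_vector_derivative_along_line: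
  assumes "(f has_derivative f') (at (x + s *\<^sub>R d) within S)" "\<And>r. r \<in> T \<Longrightarrow> x + r *\<^sub>R d \<in> S"
  shows "((\<lambda>r. f (x + r *\<^sub>R d)) has_vector_derivative f' d) (at s within T)"
proof -
  have "((\<lambda>r. x + r *\<^sub>R d) has_derivative (\<lambda>r. r *\<^sub>R d)) (at s within T)"
    by (auto intro!: derivative_eq_intros)
  moreover have "(f has_derivative f') (at (x + s *\<^sub>R d) within (\<lambda>r. x + r *\<^sub>R d) ` T)"
    by (rule has_derivative_subset[OF assms(1)]) (use assms(2) in auto)
  ultimately have "((\<lambda>r. f (x + r *\<^sub>R d)) has_derivative (\<lambda>r. f' (r *\<^sub>R d))) (at s within T)"
    by (rule has_derivative_in_compose)
  moreover have "f' (r *\<^sub>R d) = r *\<^sub>R f' d" for r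
    using assms(1) by (simp add: has_derivative_linear linear_scale)
  ultimately show ?thesis
    unfolding has_vector_derivative_def by simp
qed

lemma directional_derivative_limit:
  fixes f :: "'a::real_normed_vector \<Rightarrow> real"
  assumes "(f has_derivative f') (at x within S)" "\<eta> > 0" "\<And>t. t \<in> {0..\<eta>} \<Longrightarrow> x + t *\<^sub>R d \<in> S"
  shows "((\<lambda>t. (f (x + t *\<^sub>R d) - f x) / t) \<longlongrightarrow> f' d) (at_right 0)"
proof -
  have "((\<lambda>t. f (x + t *\<^sub>R d)) has_vector_derivative f' d) (at 0 within {0..\<eta>})"
    using assms by (intro has_vector_derivative_along_line[of _ _ _ 0]) auto
  then have "((\<lambda>t. f (x + t *\<^sub>R d)) has_field_derivative f' d) (at 0 within {0..\<eta>})"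
    by (simp add: has_real_derivative_iff_has_vector_derivative)
  then show ?thesis
    using at_within_Icc_at_right[OF \<open>\<eta> > 0\<close>] by (simp add: has_field_derivative_iff)
qed

lemma directional_derivative_le:
  fixes f :: "'a::real_normed_vector \<Rightarrow> real"
  assumes "(f has_derivative f') (at x within S)" "\<eta> > 0" "\<And>t. t \<in> {0..\<eta>} \<Longrightarrow> x + t *\<^sub>R d \<in> S"
    and decr: "\<And>t. t \<in> {0..\<eta>} \<Longrightarrow> f (x + t *\<^sub>R d) \<le> f x + t * c"
  shows "f' d \<le> c"
proof (rule tendsto_upperbound[OF directional_derivative_limit[OF assms(1-3)]])
  show "\<forall>\<^sub>F t in at_right 0. (f (x + t *\<^sub>R d) - f x) / t \<le> c"
    unfolding eventually_at_right_field
  proof (intro exI[of _ \<eta>] conjI allI impI)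
    fix t assume "t > 0" "t < \<eta>"
    then show "(f (x + t *\<^sub>R d) - f x) / t \<le> c"
      using decr[of t] by (simp add: divide_simps algebra_simps)
  qed (rule \<open>\<eta> > 0\<close>)
qed (use trivial_limit_at_right_real in auto)

lemma convex_on_above_tangent:
  fixes f :: "'a::real_normed_vector \<Rightarrow> real"
  assumes "convex_on S f" "(f has_derivative f') (at x within S)" "x \<in> S" "y \<in> S"
  shows "f' (y - x) \<le> f y - f x"
proof (rule directional_derivative_le[OF assms(2), of 1])
  fix t :: real assume t: "t \<in> {0..1}"
  have eq: "x + t *\<^sub>R (y - x) = (1 - t) *\<^sub>R x + t *\<^sub>R y"
    by (simp add: algebra_simps)
  show "x + t *\<^sub>R (y - x) \<in> S"
    using convex_on_imp_convex[OF assms(1)] assms(3,4) t unfolding eq by (auto simp: convex_alt)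
  show "f (x + t *\<^sub>R (y - x)) \<le> f x + t * (f y - f x)"
    using convex_onD[OF assms(1) _ _ assms(3,4), of t] t unfolding eq by (simp add: algebra_simps)
qed simp

text \<open>Two applications of the mean value theorem, first in direction \<open>a\<close> and then in direction \<open>b\<close>, write the
  second difference as \<open>h\<^sup>2 f''(v) b a\<close> with \<open>v\<close> in the parallelogram spanned by \<open>h a\<close> and \<open>h b\<close> at \<open>w\<close>.
  Only this parallelogram has to lie in \<open>S\<close>, so \<open>w\<close> may be a boundary point.\<close>

lemma second_difference_limit:
  fixes f :: "'a::real_normed_vector \<Rightarrow> real"
  assumes f': "\<And>v. v \<in> S \<Longrightarrow> (f has_derivative blinfun_apply (f' v)) (at v within S)"
    and f'': "\<And>v. v \<in> S \<Longrightarrow> (f' has_derivative blinfun_apply (f'' v)) (at v within S)"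
    and cont: "continuous_on S f''"
    and wedge: "\<And>s t. 0 \<le> s \<Longrightarrow> 0 \<le> t \<Longrightarrow> w + s *\<^sub>R a + t *\<^sub>R b \<in> S"
  shows "((\<lambda>h. (f (w + h *\<^sub>R a + h *\<^sub>R b) - f (w + h *\<^sub>R a) - f (w + h *\<^sub>R b) + f w) / h\<^sup>2)
    \<longlongrightarrow> blinfun_apply (blinfun_apply (f'' w) b) a) (at_right 0)"
proof (rule tendstoI)
  fix \<epsilon> :: real assume "\<epsilon> > 0"
  have "w \<in> S"
    using wedge[of 0 0] by simp
  have "continuous_on S (\<lambda>v. blinfun_apply (blinfun_apply (f'' v) b) a)"
    by (intro continuous_intros cont)
  then obtain \<delta> where "\<delta> > 0" and \<delta>: "\<And>v. v \<in> S \<Longrightarrow> dist v w < \<delta> \<Longrightarrow>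
      dist (blinfun_apply (blinfun_apply (f'' v) b) a) (blinfun_apply (blinfun_apply (f'' w) b) a) < \<epsilon>"
    using \<open>w \<in> S\<close> \<open>\<epsilon> > 0\<close> unfolding continuous_on_iff by metis
  define C where "C = norm a + norm b + 1"
  have "C > 0"
    unfolding C_def by (simp add: add_nonneg_pos)
  show "\<forall>\<^sub>F h in at_right 0. dist
      ((f (w + h *\<^sub>R a + h *\<^sub>R b) - f (w + h *\<^sub>R a) - f (w + h *\<^sub>R b) + f w) / h\<^sup>2)
      (blinfun_apply (blinfun_apply (f'' w) b) a) < \<epsilon>"
    unfolding eventually_at_right_field
  proof (intro exI[of _ "\<delta> / C"] conjI allI impI)
    show "\<delta> / C > 0"
      using \<open>\<delta> > 0\<close> \<open>C > 0\<close> by simp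
    fix h assume h: "h > 0" "h < \<delta> / C"
    define \<phi> where "\<phi> = (\<lambda>s. f ((w + h *\<^sub>R b) + s *\<^sub>R a) - f (w + s *\<^sub>R a))"
    have "(\<phi> has_derivative (\<lambda>r. r *\<^sub>R (f' ((w + h *\<^sub>R b) + s *\<^sub>R a) a - f' (w + s *\<^sub>R a) a)))
        (at s within {0..h})" if "0 \<le> s" "s \<le> h" for s
      unfolding \<phi>_def has_vector_derivative_def[symmetric]
    proof (rule has_vector_derivative_diff)
      have in_S: "w + h *\<^sub>R b + r *\<^sub>R a \<in> S" "w + r *\<^sub>R a \<in> S" if "0 \<le> r" for r
        using wedge[OF that, of h] wedge[OF that, of 0] h(1) by (simp_all add: add.commute add.left_commute)
      show "((\<lambda>s. f (w + h *\<^sub>R b + s *\<^sub>R a)) has_vector_derivative f' (w + h *\<^sub>R b + s *\<^sub>R a) a)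
          (at s within {0..h})"
        by (rule has_vector_derivative_along_line[OF f']) (use in_S that in auto)
      show "((\<lambda>s. f (w + s *\<^sub>R a)) has_vector_derivative f' (w + s *\<^sub>R a) a) (at s within {0..h})"
        by (rule has_vector_derivative_along_line[OF f']) (use in_S that in auto)
    qed
    from mvt_simple[OF \<open>h > 0\<close> this] obtain \<sigma> where \<sigma>: "0 < \<sigma>" "\<sigma> < h"
      and eq1: "\<phi> h - \<phi> 0 = h * (f' ((w + h *\<^sub>R b) + \<sigma> *\<^sub>R a) a - f' (w + \<sigma> *\<^sub>R a) a)"
      by auto
    define \<psi> where "\<psi> = (\<lambda>t. f' ((w + \<sigma> *\<^sub>R a) + t *\<^sub>R b) a)"
    have "(\<psi> has_derivative (\<lambda>r. r *\<^sub>R (f'' ((w + \<sigma> *\<^sub>R a) + t *\<^sub>R b) b a))) (at t within {0..h})"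
      if "0 \<le> t" "t \<le> h" for t
      unfolding \<psi>_def has_vector_derivative_def[symmetric]
    proof (rule bounded_linear.has_vector_derivative[OF blinfun.bounded_linear_left])
      show "((\<lambda>t. f' (w + \<sigma> *\<^sub>R a + t *\<^sub>R b)) has_vector_derivative
          f'' ((w + \<sigma> *\<^sub>R a) + t *\<^sub>R b) b) (at t within {0..h})"
        by (rule has_vector_derivative_along_line[OF f'']) (use wedge \<sigma> that in auto)
    qed
    from mvt_simple[OF \<open>h > 0\<close> this] obtain \<tau> where \<tau>: "0 < \<tau>" "\<tau> < h"
      and eq2: "\<psi> h - \<psi> 0 = h * f'' ((w + \<sigma> *\<^sub>R a) + \<tau> *\<^sub>R b) b a"
      by auto
    define v where "v = (w + \<sigma> *\<^sub>R a) + \<tau> *\<^sub>R b"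
    have "f (w + h *\<^sub>R a + h *\<^sub>R b) - f (w + h *\<^sub>R a) - f (w + h *\<^sub>R b) + f w = \<phi> h - \<phi> 0"
      unfolding \<phi>_def by (simp add: add_ac)
    also have "\<dots> = h * (\<psi> h - \<psi> 0)"
      unfolding eq1 \<psi>_def by (simp add: add_ac)
    also have "\<dots> = h\<^sup>2 * f'' v b a"
      unfolding eq2 v_def by (simp add: power2_eq_square)
    finally have quot: "(f (w + h *\<^sub>R a + h *\<^sub>R b) - f (w + h *\<^sub>R a) - f (w + h *\<^sub>R b) + f w) / h\<^sup>2
        = f'' v b a"
      using h(1) by simp
    have "dist v w \<le> \<sigma> * norm a + \<tau> * norm b"
      unfolding v_def dist_norm using norm_triangle_ineq[of "\<sigma> *\<^sub>R a" "\<tau> *\<^sub>R b"] \<sigma> \<tau>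
      by (simp add: add.assoc)
    also have "\<dots> \<le> h * norm a + h * norm b"
      using \<sigma> \<tau> by (intro add_mono mult_right_mono) auto
    also have "\<dots> < h * C"
      unfolding C_def using h(1) by (simp add: algebra_simps)
    also have "\<dots> < \<delta>"
      using h(2) \<open>C > 0\<close> by (simp add: pos_less_divide_eq)
    finally have "dist v w < \<delta>" .
    moreover have "v \<in> S"
      unfolding v_def using wedge \<sigma> \<tau> by simp
    ultimately show "dist ((f (w + h *\<^sub>R a + h *\<^sub>R b) - f (w + h *\<^sub>R a) - f (w + h *\<^sub>R b) + f w) / h\<^sup>2)
        (blinfun_apply (blinfun_apply (f'' w) b) a) < \<epsilon>"
      unfolding quot by (rule \<delta>[rotated])
  qed
qed

text \<open>The second difference is symmetric in \<open>a\<close> and \<open>b\<close>, hence so is its limit.\<close>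

lemma second_derivative_symmetric:
  fixes f :: "'a::real_normed_vector \<Rightarrow> real"
  assumes "\<And>v. v \<in> S \<Longrightarrow> (f has_derivative blinfun_apply (f' v)) (at v within S)"
    and "\<And>v. v \<in> S \<Longrightarrow> (f' has_derivative blinfun_apply (f'' v)) (at v within S)"
    and "continuous_on S f''"
    and wedge: "\<And>s t. 0 \<le> s \<Longrightarrow> 0 \<le> t \<Longrightarrow> w + s *\<^sub>R a + t *\<^sub>R b \<in> S"
  shows "blinfun_apply (blinfun_apply (f'' w) a) b = blinfun_apply (blinfun_apply (f'' w) b) a"
proof (rule tendsto_unique[OF trivial_limit_at_right_real])
  show "((\<lambda>h. (f (w + h *\<^sub>R a + h *\<^sub>R b) - f (w + h *\<^sub>R a) - f (w + h *\<^sub>R b) + f w) / h\<^sup>2)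
    \<longlongrightarrow> blinfun_apply (blinfun_apply (f'' w) b) a) (at_right 0)"
    by (rule second_difference_limit[OF assms])
  have swap: "w + t *\<^sub>R a + s *\<^sub>R b = w + s *\<^sub>R b + t *\<^sub>R a" for s t
    by (simp add: add.assoc add.commute)
  have "((\<lambda>h. (f (w + h *\<^sub>R b + h *\<^sub>R a) - f (w + h *\<^sub>R b) - f (w + h *\<^sub>R a) + f w) / h\<^sup>2)
    \<longlongrightarrow> blinfun_apply (blinfun_apply (f'' w) a) b) (at_right 0)"
  proof (rule second_difference_limit[OF assms(1-3)])
    show "w + s *\<^sub>R b + t *\<^sub>R a \<in> S" if "0 \<le> s" "0 \<le> t" for s t
      using wedge[OF that(2,1)] unfolding swap .
  qed
  then show "((\<lambda>h. (f (w + h *\<^sub>R a + h *\<^sub>R b) - f (w + h *\<^sub>R a) - f (w + h *\<^sub>R b) + f w) / h\<^sup>2)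
    \<longlongrightarrow> blinfun_apply (blinfun_apply (f'' w) a) b) (at_right 0)"
    unfolding swap by (simp add: algebra_simps)
qed

text \<open>Otherwise \<open>(A *v p) \<bullet> q \<noteq> 0\<close> for some \<open>q\<close>, and the quadratic form at \<open>l p + q\<close>, which is affine in
  \<open>l\<close> with slope \<open>2 (A *v p) \<bullet> q\<close>, takes the value \<open>1\<close>.\<close>

lemma negative_semidefinite_kernel:
  fixes A :: "real^'k^'k"
  assumes sym: "\<And>p q. (A *v p) \<bullet> q = (A *v q) \<bullet> p" and nsd: "\<And>p. (A *v p) \<bullet> p \<le> 0"
    and null: "(A *v p) \<bullet> p = 0"
  shows "A *v p = 0"
proof -
  have "(A *v p) \<bullet> q = 0" for q
  proof (rule ccontr)
    assume ne: "(A *v p) \<bullet> q \<noteq> 0"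
    define l where "l = (1 - (A *v q) \<bullet> q) / (2 * ((A *v p) \<bullet> q))"
    have "(A *v (l *\<^sub>R p + q)) \<bullet> (l *\<^sub>R p + q)
        = l * (2 * ((A *v p) \<bullet> q)) + (A *v q) \<bullet> q"
      using null sym[of q p]
      by (simp add: matrix_vector_right_distrib matrix_vector_mult_scaleR inner_simps algebra_simps)
    also have "\<dots> = 1"
      unfolding l_def using ne by simp
    finally show False
      using nsd[of "l *\<^sub>R p + q"] by simp
  qed
  then have "(A *v p) \<bullet> (A *v p) = 0" .
  then show ?thesis
    by simp
qed

lemma integral_matrix_vector_mult_eq_0:
  fixes A :: "real \<Rightarrow> real^'k^'l"
  assumes "\<And>s. s \<in> S \<Longrightarrow> A s *v p = 0"
  shows "integral S A *v p = 0"
\<comment> \<open>A matrix function that is not integrable has integral \<open>0\<close>, which annihilates every vector.\<close>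
proof (cases "A integrable_on S")
  case True
  have "linear (\<lambda>M :: real^'k^'l. M *v p)"
    by (rule linearI) (simp_all add: matrix_vector_mult_add_rdistrib scaleR_matrix_vector_assoc)
  then have "integral S ((\<lambda>M. M *v p) \<circ> A) = integral S A *v p"
    by (intro integral_linear True) (simp add: linear_conv_bounded_linear)
  moreover have "integral S ((\<lambda>M. M *v p) \<circ> A) = integral S (\<lambda>s. 0)"
    by (rule integral_cong) (simp add: assms)
  ultimately show ?thesis
    by simp
qed (simp add: not_integrable_integral)

text \<open>A condition that makes derivatives within \<open>S\<close> at \<open>x\<close> unique and that holds at every point of the
  orthant, including its faces.\<close>

definition axis_approachable :: "'a::euclidean_space set \<Rightarrow> 'a \<Rightarrow> bool" where
  "axis_approachable S x \<longleftrightarrow> (\<forall>i\<in>Basis. \<forall>e>0. \<exists>d. 0 < \<bar>d\<bar> \<and> \<bar>d\<bar> < e \<and> x + d *\<^sub>R i \<in> S)"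

lemma frechet_derivative_within_eq:
  fixes f :: "'a::euclidean_space \<Rightarrow> 'b::real_normed_vector"
  assumes "(f has_derivative f') (at x within S)" "axis_approachable S x"
  shows "frechet_derivative f (at x within S) = f'"
proof (rule frechet_derivative_unique_within)
  show "(f has_derivative frechet_derivative f (at x within S)) (at x within S)"
    using assms(1) frechet_derivative_works differentiable_def by blast
qed (use assms in \<open>auto simp: axis_approachable_def\<close>)

text \<open>A coordinate-free description of the gradient. Together with the next lemma it reduces all statements about
  the gradient and Hessian blocks to the derivatives \<open>f'\<close> and \<open>f''\<close> of \<open>F\<close> within the domain.\<close>

lemma gradient_inner:
  fixes f :: "real^'k \<Rightarrow> real"
  assumes f': "(f has_derivative f') (at x within S)" and "axis_approachable S x"
  shows "gradient f (at x within S) \<bullet> u = f' u"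
proof -
  have lin: "linear f'"
    using f' by (rule has_derivative_linear)
  have "f' u = f' (\<Sum>i\<in>UNIV. u $ i *\<^sub>R axis i 1)"
    using basis_expansion[of u] by (simp add: scalar_mult_eq_scaleR)
  also have "\<dots> = (\<Sum>i\<in>UNIV. u $ i * f' (axis i 1))"
    using lin by (simp add: linear_sum linear_scale)
  also have "\<dots> = gradient f (at x within S) \<bullet> u"
    unfolding gradient_def frechet_derivative_within_eq[OF assms]
    by (simp add: inner_vec_def mult.commute)
  finally show ?thesis by simp
qed

lemma jacobian_inner:
  fixes g :: "real^'k \<Rightarrow> real^'l"
  assumes B: "\<And>b. ((\<lambda>v. g v \<bullet> b) has_derivative (\<lambda>u. B u b)) (at x within S)"
    and x: "axis_approachable S x"
  shows "(jacobian g (at x within S) *v u) \<bullet> b = B u b"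
proof -
  define D where "D = (\<lambda>u. \<Sum>i\<in>Basis. B u i *\<^sub>R i)"
  have "(g has_derivative D) (at x within S)"
    unfolding has_derivative_componentwise_within[of g] D_def
    using B by (simp add: inner_sum_left_Basis)
  then have "(g has_derivative (*v) (jacobian g (at x within S))) (at x within S)"
    using jacobian_works differentiable_def by blast
  then have "((\<lambda>v. g v \<bullet> b) has_derivative (\<lambda>u. (jacobian g (at x within S) *v u) \<bullet> b)) (at x within S)"
    by (rule has_derivative_inner_left)
  then have "(\<lambda>u. (jacobian g (at x within S) *v u) \<bullet> b) = (\<lambda>u. B u b)"
    by (rule frechet_derivative_unique_within[OF _ B]) (use x in \<open>auto simp: axis_approachable_def\<close>)
  then show ?thesis
    by (rule fun_cong)
qed

section \<open>Block vectors and matrices\<close>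

lemma sum_UNIV_Plus:
  "(\<Sum>i\<in>UNIV. f i) = (\<Sum>i\<in>UNIV. f (Inl i)) + (\<Sum>i\<in>UNIV. f (Inr i))"
  for f :: "'k::finite + 'l::finite \<Rightarrow> real"
  unfolding UNIV_Plus_UNIV[symmetric] by (subst sum.Plus) simp_all

lemma concat_vec_inner: "concat_vec u w \<bullet> concat_vec u' w' = u \<bullet> u' + w \<bullet> (w' :: real^'l)"
  unfolding inner_vec_def concat_vec_def by (simp add: sum_UNIV_Plus)

lemma concat_vec_surj: "\<exists>u w. p = concat_vec u w"
proof -
  have "p = concat_vec (\<chi> i. p $ Inl i) (\<chi> i. p $ Inr i)"
    unfolding concat_vec_def vec_eq_iff by (auto split: sum.split)
  then show ?thesis by blast
qed

lemma block_matrix_mult: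
  fixes A :: "real^'c^'r"
  shows "block_matrix A B C D *v concat_vec u w = concat_vec (A *v u + B *v w) (C *v u + D *v w)"
  unfolding vec_eq_iff block_matrix_def matrix_vector_mult_def concat_vec_def
  by (auto simp: sum_UNIV_Plus split: sum.split)

section \<open>The domain\<close>

lemma nonneg_orthant_approachable:
  fixes y :: "real^'p"
  assumes "y \<in> nonneg_orthant"
  shows "axis_approachable nonneg_orthant y"
  unfolding axis_approachable_def
proof (intro ballI allI impI)
  fix i :: "real^'p" and e :: real assume "i \<in> Basis" "e > 0"
  then obtain k where "i = axis k 1"
    by (auto simp: Basis_vec_def)
  then show "\<exists>d. 0 < \<bar>d\<bar> \<and> \<bar>d\<bar> < e \<and> y + d *\<^sub>R i \<in> nonneg_orthant"
    using assms \<open>e > 0\<close>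
    by (intro exI[of _ "e / 2"]) (auto simp: nonneg_orthant_def axis_def)
qed

lemma UNIV_approachable: "axis_approachable UNIV x"
  unfolding axis_approachable_def
proof (intro ballI allI impI)
  fix i :: 'a and e :: real assume "e > 0"
  then show "\<exists>d. 0 < \<bar>d\<bar> \<and> \<bar>d\<bar> < e \<and> x + d *\<^sub>R i \<in> UNIV"
    by (intro exI[of _ "e / 2"]) auto
qed

lemma saddle_domain_iff: "(x, y, z) \<in> saddle_domain \<longleftrightarrow> y \<in> nonneg_orthant"
  unfolding saddle_domain_def by auto

lemma closed_saddle_domain: "closed (saddle_domain :: ((real^'n) \<times> (real^'p) \<times> (real^'m)) set)"
proof -
  have "(nonneg_orthant :: (real^'p) set) = {y. 0 \<le> y}"
    unfolding nonneg_orthant_def less_eq_vec_def by simp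
  also have "closed \<dots>"
    unfolding less_eq_vec_def by (simp add: closed_Collect_all closed_Collect_le continuous_on_component)
  finally show ?thesis
    unfolding saddle_domain_def by (intro closed_Times) auto
qed

lemma saddle_domain_add: "v \<in> saddle_domain \<Longrightarrow> w \<in> saddle_domain \<Longrightarrow> v + w \<in> saddle_domain"
  unfolding saddle_domain_def nonneg_orthant_def by auto

lemma saddle_domain_scaleR: "v \<in> saddle_domain \<Longrightarrow> 0 \<le> c \<Longrightarrow> c *\<^sub>R v \<in> saddle_domain"
  unfolding saddle_domain_def nonneg_orthant_def by auto

lemma saddle_domain_segment:
  assumes "v \<in> saddle_domain" "w \<in> saddle_domain" "s \<in> {0..1}"
  shows "v + s *\<^sub>R (w - v) \<in> saddle_domain"
proof -
  have "v + s *\<^sub>R (w - v) = (1 - s) *\<^sub>R v + s *\<^sub>R w"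
    by (simp add: algebra_simps)
  then show ?thesis
    using assms by (simp add: saddle_domain_add saddle_domain_scaleR)
qed

text \<open>Identities that are linear in a direction, such as the symmetry of \<open>f''\<close>, thus need only be checked for
  directions that point into the domain.\<close>

lemma saddle_domain_generates:
  obtains a b where "p = a - b" "a \<in> saddle_domain" "b \<in> saddle_domain"
proof -
  obtain x y z where p: "p = (x, y, z)"
    using prod_cases3 by blast
  define y1 y2 where "y1 = (\<chi> i. max (y $ i) 0)" and "y2 = (\<chi> i. max (- (y $ i)) 0)"
  have "y = y1 - y2"
    unfolding y1_def y2_def vec_eq_iff by (auto simp: max_def)
  then have "p = (x, y1, z) - (0, y2, 0)"
    unfolding p by simp
  moreover have "(x, y1, z) \<in> saddle_domain" "(0, y2, 0) \<in> saddle_domain"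
    unfolding saddle_domain_iff nonneg_orthant_def y1_def y2_def by auto
  ultimately show ?thesis
    using that by blast
qed

section \<open>The saddle operator and its projection\<close>

definition saddle_operator ::
  "((real^'n) \<times> (real^'p) \<times> (real^'m) \<Rightarrow> real) \<Rightarrow>
     (real^'n) \<times> (real^'p) \<times> (real^'m) \<Rightarrow> (real^'n) \<times> (real^'p) \<times> (real^'m)" where
  "saddle_operator F w = (- grad_x F w, grad_y F w, grad_z F w)"

definition flip_x :: "(real^'n) \<times> (real^'p) \<times> (real^'m) \<Rightarrow> (real^'n) \<times> (real^'p) \<times> (real^'m)" where
  "flip_x = (\<lambda>(x, y, z). (- x, y, z))"

lemma flip_x_simp [simp]: "flip_x (x, y, z) = (- x, y, z)"
  unfolding flip_x_def by simp

lemma norm_flip_x: "norm (flip_x w) = norm w"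
  by (cases w) (simp add: norm_Pair)

lemma continuous_on_flip_x: "continuous_on S g \<Longrightarrow> continuous_on S (\<lambda>w. flip_x (g w))"
  unfolding flip_x_def case_prod_unfold by (intro continuous_intros)

text \<open>A component is changed by the projection only where \<open>y\<close> vanishes and \<open>g\<close> is negative; there the
  correction is positive and \<open>y - y'\<close> is nonpositive.\<close>

lemma pos_proj_vec_obtuse:
  assumes "y \<in> nonneg_orthant" "y' \<in> nonneg_orthant"
  shows "(pos_proj_vec g y - g) \<bullet> (y - y') \<le> 0"
  unfolding inner_vec_def
proof (rule sum_nonpos)
  fix i
  have "y $ i \<ge> 0" "y' $ i \<ge> 0"
    using assms unfolding nonneg_orthant_def by auto
  then show "(pos_proj_vec g y - g) $ i \<bullet> (y - y') $ i \<le> 0"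
    by (cases "y $ i = 0") (auto simp: pos_proj_vec_def pos_proj_def max_def mult_nonneg_nonneg mult_nonpos_nonneg)
qed

lemma psp_field_inner_le:
  assumes "w \<in> saddle_domain" "v \<in> saddle_domain"
  shows "psp_field F w \<bullet> (w - v) \<le> saddle_operator F w \<bullet> (w - v)"
proof -
  obtain x y z x' y' z' where w: "w = (x, y, z)" and v: "v = (x', y', z')"
    using prod_cases3 by metis
  show ?thesis
    using pos_proj_vec_obtuse[of y y' "grad_y F w"] assms
    unfolding w v saddle_domain_iff psp_field_def saddle_operator_def
    by (simp add: inner_diff_left)
qed

lemma norm_psp_field_le: "norm (psp_field F w) \<le> norm (saddle_operator F w)"
proof -
  obtain x y z where w: "w = (x, y, z)"
    using prod_cases3 by metis
  have "norm (pos_proj_vec g y) \<le> norm g" for g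
    by (rule norm_le_componentwise_cart) (auto simp: pos_proj_vec_def pos_proj_def)
  then show ?thesis
    unfolding w psp_field_def saddle_operator_def by (simp add: norm_Pair power_mono)
qed

lemma Saddle_subset: "Saddle F \<subseteq> saddle_domain"
  unfolding Saddle_def by auto

section \<open>The gradient and Hessian blocks\<close>

lemma embedding_derivatives:
  "((\<lambda>x. (x, y, z)) has_derivative (\<lambda>u. (u, 0, 0))) (at x within A)"
  "((\<lambda>y. (x, y, z)) has_derivative (\<lambda>v. (0, v, 0))) (at y within B)"
  "((\<lambda>z. (x, y, z)) has_derivative (\<lambda>t. (0, 0, t))) (at z within C)"
  "((\<lambda>q. (x, q)) has_derivative (\<lambda>q. (0, q))) (at q within D)"
  by (auto intro!: derivative_eq_intros simp: fun_eq_iff zero_prod_def)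

text \<open>Here \<open>f'\<close> and \<open>f''\<close> are the first and second derivative of \<open>F\<close> within the domain. In
  \<open>f'' w p q\<close>, the direction \<open>p\<close> is the one in which \<open>f'\<close> is differentiated.\<close>

locale C2_convex_concave =
  fixes F :: "(real^'n) \<times> (real^'p) \<times> (real^'m) \<Rightarrow> real"
    and f' :: "(real^'n) \<times> (real^'p) \<times> (real^'m) \<Rightarrow> ((real^'n) \<times> (real^'p) \<times> (real^'m)) \<Rightarrow>\<^sub>L real"
    and f'' :: "(real^'n) \<times> (real^'p) \<times> (real^'m) \<Rightarrow>
      ((real^'n) \<times> (real^'p) \<times> (real^'m)) \<Rightarrow>\<^sub>L ((real^'n) \<times> (real^'p) \<times> (real^'m)) \<Rightarrow>\<^sub>L real"
  assumes deriv: "\<And>w. w \<in> saddle_domain \<Longrightarrow>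
      (F has_derivative blinfun_apply (f' w)) (at w within saddle_domain)"
    and deriv2: "\<And>w. w \<in> saddle_domain \<Longrightarrow>
      (f' has_derivative blinfun_apply (f'' w)) (at w within saddle_domain)"
    and cont2: "continuous_on saddle_domain f''"
    and convex_concave: "convex_concave F"
begin

lemma partial_derivatives:
  assumes y: "y \<in> nonneg_orthant"
  shows deriv_x: "((\<lambda>x. F (x, y, z)) has_derivative (\<lambda>u. f' (x, y, z) (u, 0, 0))) (at x)"
    and deriv_y: "((\<lambda>y. F (x, y, z)) has_derivative (\<lambda>v. f' (x, y, z) (0, v, 0))) (at y within nonneg_orthant)"
    and deriv_z: "((\<lambda>z. F (x, y, z)) has_derivative (\<lambda>t. f' (x, y, z) (0, 0, t))) (at z)"
    and deriv_yz: "((\<lambda>q. F (x, q)) has_derivative (\<lambda>q. f' (x, y, z) (0, q)))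
      (at (y, z) within nonneg_orthant \<times> UNIV)"
proof -
  note chain = has_derivative_in_compose2[OF deriv _ _ embedding_derivatives(1)]
    has_derivative_in_compose2[OF deriv _ _ embedding_derivatives(2)]
    has_derivative_in_compose2[OF deriv _ _ embedding_derivatives(3)]
    has_derivative_in_compose2[OF deriv _ _ embedding_derivatives(4)]
  show "((\<lambda>x. F (x, y, z)) has_derivative (\<lambda>u. f' (x, y, z) (u, 0, 0))) (at x)"
    by (rule chain(1)) (use y in \<open>auto simp: saddle_domain_iff\<close>)
  show "((\<lambda>y. F (x, y, z)) has_derivative (\<lambda>v. f' (x, y, z) (0, v, 0))) (at y within nonneg_orthant)"
    by (rule chain(2)) (use y in \<open>auto simp: saddle_domain_iff\<close>)
  show "((\<lambda>z. F (x, y, z)) has_derivative (\<lambda>t. f' (x, y, z) (0, 0, t))) (at z)"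
    by (rule chain(3)) (use y in \<open>auto simp: saddle_domain_iff\<close>)
  show "((\<lambda>q. F (x, q)) has_derivative (\<lambda>q. f' (x, y, z) (0, q))) (at (y, z) within nonneg_orthant \<times> UNIV)"
    by (rule chain(4)) (use y in \<open>auto simp: saddle_domain_iff\<close>)
qed

lemma second_partial_derivatives:
  assumes y: "y \<in> nonneg_orthant"
  shows deriv2_x: "((\<lambda>x. f' (x, y, z) b) has_derivative (\<lambda>u. f'' (x, y, z) (u, 0, 0) b)) (at x)"
    and deriv2_y: "((\<lambda>y. f' (x, y, z) b) has_derivative (\<lambda>v. f'' (x, y, z) (0, v, 0) b))
      (at y within nonneg_orthant)"
    and deriv2_z: "((\<lambda>z. f' (x, y, z) b) has_derivative (\<lambda>t. f'' (x, y, z) (0, 0, t) b)) (at z)"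
proof -
  note deriv_b = bounded_linear.has_derivative[OF blinfun.bounded_linear_left deriv2]
  note chain = has_derivative_in_compose2[OF deriv_b _ _ embedding_derivatives(1)]
    has_derivative_in_compose2[OF deriv_b _ _ embedding_derivatives(2)]
    has_derivative_in_compose2[OF deriv_b _ _ embedding_derivatives(3)]
  show "((\<lambda>x. f' (x, y, z) b) has_derivative (\<lambda>u. f'' (x, y, z) (u, 0, 0) b)) (at x)"
    by (rule chain(1)) (use y in \<open>auto simp: saddle_domain_iff\<close>)
  show "((\<lambda>y. f' (x, y, z) b) has_derivative (\<lambda>v. f'' (x, y, z) (0, v, 0) b)) (at y within nonneg_orthant)"
    by (rule chain(2)) (use y in \<open>auto simp: saddle_domain_iff\<close>)
  show "((\<lambda>z. f' (x, y, z) b) has_derivative (\<lambda>t. f'' (x, y, z) (0, 0, t) b)) (at z)"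
    by (rule chain(3)) (use y in \<open>auto simp: saddle_domain_iff\<close>)
qed

lemma grad_inner:
  assumes "(x, y, z) \<in> saddle_domain"
  shows "grad_x F (x, y, z) \<bullet> u = f' (x, y, z) (u, 0, 0)"
    and "grad_y F (x, y, z) \<bullet> v = f' (x, y, z) (0, v, 0)"
    and "grad_z F (x, y, z) \<bullet> t = f' (x, y, z) (0, 0, t)"
  using assms unfolding saddle_domain_iff grad_x_def grad_y_def grad_z_def
  by (simp_all add: gradient_inner[OF deriv_x] gradient_inner[OF deriv_y] gradient_inner[OF deriv_z]
      nonneg_orthant_approachable UNIV_approachable)

text \<open>\<open>G\<close> is the gradient of \<open>F\<close> with the sign of its \<open>x\<close>-part reversed.\<close>

lemma saddle_operator_inner:
  assumes "w \<in> saddle_domain"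
  shows "saddle_operator F w \<bullet> d = f' w (flip_x d)"
proof -
  obtain x y z u v t where w: "w = (x, y, z)" and d: "d = (u, v, t)"
    using prod_cases3 by metis
  have "saddle_operator F w \<bullet> d = f' w (- u, 0, 0) + f' w (0, v, 0) + f' w (0, 0, t)"
    using assms grad_inner[of x y z]
    by (simp add: saddle_operator_def w d flip: grad_inner)
  also have "\<dots> = f' w (flip_x d)"
    unfolding d by (simp flip: blinfun.add_right)
  finally show ?thesis .
qed

lemma hess_inner:
  assumes w: "(x, y, z) \<in> saddle_domain"
  shows "(hess_xx F (x, y, z) *v u) \<bullet> a = f'' (x, y, z) (u, 0, 0) (a, 0, 0)"
    and "(hess_yy F (x, y, z) *v v) \<bullet> b = f'' (x, y, z) (0, v, 0) (0, b, 0)"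
    and "(hess_yz F (x, y, z) *v t) \<bullet> b = f'' (x, y, z) (0, 0, t) (0, b, 0)"
    and "(hess_zy F (x, y, z) *v v) \<bullet> c = f'' (x, y, z) (0, v, 0) (0, 0, c)"
    and "(hess_zz F (x, y, z) *v t) \<bullet> c = f'' (x, y, z) (0, 0, t) (0, 0, c)"
proof -
  have y: "y \<in> nonneg_orthant"
    using w unfolding saddle_domain_iff .
  have "((\<lambda>x. grad_x F (x, y, z) \<bullet> a) has_derivative (\<lambda>u. f'' (x, y, z) (u, 0, 0) (a, 0, 0))) (at x)" for a
    using deriv2_x[OF y] y by (simp add: grad_inner saddle_domain_iff)
  from jacobian_inner[where B = "\<lambda>u a. f'' (x, y, z) (u, 0, 0) (a, 0, 0)", OF this UNIV_approachable]
  show "(hess_xx F (x, y, z) *v u) \<bullet> a = f'' (x, y, z) (u, 0, 0) (a, 0, 0)"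
    unfolding hess_xx_def by simp
  have "((\<lambda>y. grad_y F (x, y, z) \<bullet> b) has_derivative (\<lambda>v. f'' (x, y, z) (0, v, 0) (0, b, 0)))
      (at y within nonneg_orthant)" for b
    by (rule has_derivative_transform[OF y _ deriv2_y[OF y]]) (simp add: grad_inner saddle_domain_iff)
  from jacobian_inner[where B = "\<lambda>v b. f'' (x, y, z) (0, v, 0) (0, b, 0)", OF this nonneg_orthant_approachable[OF y]]
  show "(hess_yy F (x, y, z) *v v) \<bullet> b = f'' (x, y, z) (0, v, 0) (0, b, 0)"
    unfolding hess_yy_def by simp
  have "((\<lambda>z. grad_y F (x, y, z) \<bullet> b) has_derivative (\<lambda>t. f'' (x, y, z) (0, 0, t) (0, b, 0))) (at z)" for b
    using deriv2_z[OF y] y by (simp add: grad_inner saddle_domain_iff)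
  from jacobian_inner[where B = "\<lambda>t b. f'' (x, y, z) (0, 0, t) (0, b, 0)", OF this UNIV_approachable]
  show "(hess_yz F (x, y, z) *v t) \<bullet> b = f'' (x, y, z) (0, 0, t) (0, b, 0)"
    unfolding hess_yz_def by simp
  have "((\<lambda>y. grad_z F (x, y, z) \<bullet> c) has_derivative (\<lambda>v. f'' (x, y, z) (0, v, 0) (0, 0, c)))
      (at y within nonneg_orthant)" for c
    by (rule has_derivative_transform[OF y _ deriv2_y[OF y]]) (simp add: grad_inner saddle_domain_iff)
  from jacobian_inner[where B = "\<lambda>v c. f'' (x, y, z) (0, v, 0) (0, 0, c)", OF this nonneg_orthant_approachable[OF y]]
  show "(hess_zy F (x, y, z) *v v) \<bullet> c = f'' (x, y, z) (0, v, 0) (0, 0, c)"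
    unfolding hess_zy_def by simp
  have "((\<lambda>z. grad_z F (x, y, z) \<bullet> c) has_derivative (\<lambda>t. f'' (x, y, z) (0, 0, t) (0, 0, c))) (at z)" for c
    using deriv2_z[OF y] y by (simp add: grad_inner saddle_domain_iff)
  from jacobian_inner[where B = "\<lambda>t c. f'' (x, y, z) (0, 0, t) (0, 0, c)", OF this UNIV_approachable]
  show "(hess_zz F (x, y, z) *v t) \<bullet> c = f'' (x, y, z) (0, 0, t) (0, 0, c)"
    unfolding hess_zz_def by simp
qed

lemma H_mat_inner:
  assumes "w \<in> saddle_domain"
  shows "(H_mat F w *v concat_vec u (concat_vec v t)) \<bullet> concat_vec a (concat_vec b c)
    = f'' w (0, v, t) (0, b, c) - f'' w (u, 0, 0) (a, 0, 0)"
proof -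
  obtain x y z where w: "w = (x, y, z)"
    using prod_cases3 by metis
  have minus: "(- A) *v u = - (A *v u)" for A :: "real^'n^'n"
    using matrix_vector_mult_diff_rdistrib[of 0 A u] by simp
  have "f'' w (0, v, t) = f'' w (0, v, 0) + f'' w (0, 0, t)"
    by (simp flip: blinfun.add_right)
  moreover have "f'' w d (0, b, c) = f'' w d (0, b, 0) + f'' w d (0, 0, c)" for d
    by (simp flip: blinfun.add_right)
  ultimately show ?thesis
    using hess_inner[of x y z] assms
    unfolding H_mat_def block_matrix_mult concat_vec_inner w
    by (simp add: minus concat_vec_inner inner_add_left blinfun.add_left)
qed

text \<open>At every point of the domain two inward directions span a cone that stays in the domain, since the domain is a
  convex cone; bilinearity extends the symmetry to all directions.\<close>

lemma f''_symmetric: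
  assumes "w \<in> saddle_domain"
  shows "f'' w p q = f'' w q p"
proof -
  have cone: "f'' w a b = f'' w b a" if "a \<in> saddle_domain" "b \<in> saddle_domain" for a b
    by (rule second_derivative_symmetric[OF deriv deriv2 cont2])
      (use that assms in \<open>simp_all add: saddle_domain_add saddle_domain_scaleR\<close>)
  obtain a b where p: "p = a - b" "a \<in> saddle_domain" "b \<in> saddle_domain"
    by (rule saddle_domain_generates)
  obtain c d where q: "q = c - d" "c \<in> saddle_domain" "d \<in> saddle_domain"
    by (rule saddle_domain_generates)
  show ?thesis
    unfolding p(1) q(1) using p(2,3) q(2,3)
    by (simp add: cone blinfun.diff_left blinfun.diff_right)
qed

lemma H_mat_symmetric:
  assumes "w \<in> saddle_domain"
  shows "(H_mat F w *v p) \<bullet> q = (H_mat F w *v q) \<bullet> p"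
proof -
  obtain u v t a b c where "p = concat_vec u (concat_vec v t)" "q = concat_vec a (concat_vec b c)"
    by (metis concat_vec_surj)
  then show ?thesis
    using H_mat_inner[OF assms] f''_symmetric[OF assms] by simp
qed

text \<open>By symmetry of \<open>f''\<close> the mixed terms between the \<open>x\<close> and the \<open>(y, z)\<close> directions cancel on the right,
  which is the derivative of \<open>G\<close> in direction \<open>d = (u, v, t)\<close> paired with \<open>d\<close>.\<close>

lemma H_mat_quadratic:
  assumes "w \<in> saddle_domain"
  shows "(H_mat F w *v concat_vec u (concat_vec v t)) \<bullet> concat_vec u (concat_vec v t)
    = f'' w (u, v, t) (flip_x (u, v, t))"
proof -
  have "f'' w (u, v, t) (flip_x (u, v, t)) = f'' w ((u, 0, 0) + (0, v, t)) ((0, v, t) - (u, 0, 0))"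
    by simp
  also have "\<dots> = f'' w (0, v, t) (0, v, t) - f'' w (u, 0, 0) (u, 0, 0)"
    using f''_symmetric[OF assms, of "(u, 0, 0)" "(0, v, t)"]
    by (simp only: blinfun.add_left blinfun.add_right blinfun.diff_right)
  finally show ?thesis
    unfolding H_mat_inner[OF assms] by simp
qed

section \<open>Dissipativity and the kernel of the averaged Hessian\<close>

text \<open>The tangent inequalities at \<open>(x, y, z)\<close> of the convex function \<open>F(\<cdot>, y, z)\<close> and of the concave function
  \<open>F(x, \<cdot>, \<cdot>)\<close>, added up.\<close>

lemma saddle_operator_le:
  assumes "(x, y, z) \<in> saddle_domain" "(x', y', z') \<in> saddle_domain"
  shows "saddle_operator F (x, y, z) \<bullet> ((x, y, z) - (x', y', z')) \<le> F (x', y, z) - F (x, y', z')"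
proof -
  have y: "y \<in> nonneg_orthant" "y' \<in> nonneg_orthant"
    using assms unfolding saddle_domain_iff by auto
  have "convex_on UNIV (\<lambda>x. F (x, y, z))"
    using convex_concave y unfolding convex_concave_def by auto
  from convex_on_above_tangent[OF this deriv_x[OF y(1)], of x x']
  have 1: "f' (x, y, z) (x' - x, 0, 0) \<le> F (x', y, z) - F (x, y, z)"
    by simp
  have "convex_on (nonneg_orthant \<times> UNIV) (\<lambda>q. - F (x, q))"
    using convex_concave unfolding convex_concave_def concave_on_def by (simp add: case_prod_unfold)
  from convex_on_above_tangent[OF this has_derivative_minus[OF deriv_yz[OF y(1)]], of z "(y', z')"]
  have 2: "- f' (x, y, z) (0, y' - y, z' - z) \<le> F (x, y, z) - F (x, y', z')"
    using y by simp
  have "flip_x ((x, y, z) - (x', y', z')) = (x' - x, 0, 0) - (0, y' - y, z' - z)"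
    by simp
  then have "saddle_operator F (x, y, z) \<bullet> ((x, y, z) - (x', y', z'))
      = f' (x, y, z) (x' - x, 0, 0) - f' (x, y, z) (0, y' - y, z' - z)"
    unfolding saddle_operator_inner[OF assms(1)] by (simp only: blinfun.diff_right)
  then show ?thesis
    using 1 2 by linarith
qed

text \<open>Exchanging the two points changes the sign of the bound in \<open>saddle_operator_le\<close>.\<close>

lemma saddle_operator_dissipative: "dissipative_on saddle_domain (saddle_operator F)"
  unfolding dissipative_on_def
proof (intro ballI)
  fix v w :: "(real^'n) \<times> (real^'p) \<times> (real^'m)"
  assume vw: "v \<in> saddle_domain" "w \<in> saddle_domain"
  obtain x y z x' y' z' where v: "v = (x, y, z)" and w: "w = (x', y', z')"
    using prod_cases3 by metis
  have "(saddle_operator F v - saddle_operator F w) \<bullet> (v - w)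
      = saddle_operator F v \<bullet> (v - w) + saddle_operator F w \<bullet> (w - v)"
    by (simp add: inner_simps)
  also have "\<dots> \<le> 0"
    using saddle_operator_le[of x y z x' y' z'] saddle_operator_le[of x' y' z' x y z] vw
    unfolding v w by linarith
  finally show "(saddle_operator F v - saddle_operator F w) \<bullet> (v - w) \<le> 0" .
qed

lemma psp_field_dissipative: "dissipative_on saddle_domain (psp_field F)"
  unfolding dissipative_on_def
proof (intro ballI)
  fix v w :: "(real^'n) \<times> (real^'p) \<times> (real^'m)"
  assume vw: "v \<in> saddle_domain" "w \<in> saddle_domain"
  have "(psp_field F v - psp_field F w) \<bullet> (v - w) = psp_field F v \<bullet> (v - w) + psp_field F w \<bullet> (w - v)"
    by (simp add: inner_simps)
  also have "\<dots> \<le> saddle_operator F v \<bullet> (v - w) + saddle_operator F w \<bullet> (w - v)"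
    using vw by (intro add_mono psp_field_inner_le)
  also have "\<dots> = (saddle_operator F v - saddle_operator F w) \<bullet> (v - w)"
    by (simp add: inner_simps)
  also have "\<dots> \<le> 0"
    using saddle_operator_dissipative vw unfolding dissipative_on_def by blast
  finally show "(psp_field F v - psp_field F w) \<bullet> (v - w) \<le> 0" .
qed

lemma saddle_operator_along_line:
  assumes "\<And>s. s \<in> T \<Longrightarrow> w + s *\<^sub>R d \<in> saddle_domain" "s \<in> T"
  shows "((\<lambda>s. saddle_operator F (w + s *\<^sub>R d) \<bullet> d) has_vector_derivative
    f'' (w + s *\<^sub>R d) d (flip_x d)) (at s within T)"
proof (rule has_vector_derivative_transform[OF assms(2)])
  show "((\<lambda>s. f' (w + s *\<^sub>R d) (flip_x d)) has_vector_derivative f'' (w + s *\<^sub>R d) d (flip_x d))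
      (at s within T)"
    by (rule bounded_linear.has_vector_derivative[OF blinfun.bounded_linear_left
          has_vector_derivative_along_line[OF deriv2]]) (use assms in auto)
qed (use assms in \<open>simp add: saddle_operator_inner\<close>)

lemma saddle_operator_antimono_along_line:
  assumes "w + r *\<^sub>R d \<in> saddle_domain" "w + s *\<^sub>R d \<in> saddle_domain" "r \<le> s"
  shows "saddle_operator F (w + s *\<^sub>R d) \<bullet> d \<le> saddle_operator F (w + r *\<^sub>R d) \<bullet> d"
proof (cases "r = s")
  case False
  have "(saddle_operator F (w + s *\<^sub>R d) - saddle_operator F (w + r *\<^sub>R d)) \<bullet>
      ((w + s *\<^sub>R d) - (w + r *\<^sub>R d)) \<le> 0"
    using saddle_operator_dissipative assms unfolding dissipative_on_def by blast
  then have "(s - r) * ((saddle_operator F (w + s *\<^sub>R d) - saddle_operator F (w + r *\<^sub>R d)) \<bullet> d) \<le> 0"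
    by (simp add: scaleR_left_diff_distrib[symmetric])
  then show ?thesis
    using False assms(3) by (simp add: mult_le_0_iff inner_diff_left)
qed simp

text \<open>By dissipativity of \<open>G\<close> the left-hand side, its derivative paired with the direction \<open>p\<close>, is nonpositive
  wherever one can move a little in direction \<open>p\<close>. At a boundary point this may be impossible. Writing
  \<open>p = a - b\<close> with \<open>a\<close> and \<open>b\<close> in the domain, it is possible at \<open>w + \<epsilon> b\<close>, and continuity of
  \<open>f''\<close> gives the claim as \<open>\<epsilon>\<close> tends to \<open>0\<close>.\<close>

lemma f''_flip_nonpos:
  assumes "w \<in> saddle_domain"
  shows "f'' w p (flip_x p) \<le> 0"
proof -
  obtain a b where p: "p = a - b" "a \<in> saddle_domain" "b \<in> saddle_domain"
    by (rule saddle_domain_generates)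
  have interior: "f'' (w + \<epsilon> *\<^sub>R b) p (flip_x p) \<le> 0" if "\<epsilon> > 0" for \<epsilon>
  proof -
    define v where "v = w + \<epsilon> *\<^sub>R b"
    have "v \<in> saddle_domain"
      unfolding v_def using assms p that by (simp add: saddle_domain_add saddle_domain_scaleR)
    have ray: "v + t *\<^sub>R p \<in> saddle_domain" if "t \<in> {0..\<epsilon>}" for t
    proof -
      have "v + t *\<^sub>R p = w + ((\<epsilon> - t) *\<^sub>R b + t *\<^sub>R a)"
        unfolding v_def p(1) by (simp add: algebra_simps)
      then show ?thesis
        using assms p that by (simp add: saddle_domain_add saddle_domain_scaleR)
    qed
    show ?thesis
      unfolding v_def[symmetric]
    proof (rule directional_derivative_le[where f = "\<lambda>w. f' w (flip_x p)"
          and f' = "\<lambda>d. f'' v d (flip_x p)", OF _ \<open>\<epsilon> > 0\<close> ray])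
      show "((\<lambda>w. f' w (flip_x p)) has_derivative (\<lambda>d. f'' v d (flip_x p))) (at v within saddle_domain)"
        by (rule bounded_linear.has_derivative[OF blinfun.bounded_linear_left deriv2[OF \<open>v \<in> saddle_domain\<close>]])
      show "f' (v + t *\<^sub>R p) (flip_x p) \<le> f' v (flip_x p) + t * 0" if "t \<in> {0..\<epsilon>}" for t
        using saddle_operator_antimono_along_line[of v 0 p t] ray[OF that] \<open>v \<in> saddle_domain\<close> that
        by (simp add: saddle_operator_inner)
    qed
  qed
  have "continuous_on saddle_domain (\<lambda>v. f'' v p (flip_x p))"
    by (intro continuous_intros cont2)
  then have "continuous_on {0..1} (\<lambda>\<epsilon>::real. f'' (w + \<epsilon> *\<^sub>R b) p (flip_x p))"
    by (rule continuous_on_compose2)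
      (use assms p in \<open>auto intro!: continuous_intros simp: saddle_domain_add saddle_domain_scaleR\<close>)
  then have "((\<lambda>\<epsilon>. f'' (w + \<epsilon> *\<^sub>R b) p (flip_x p)) \<longlongrightarrow> f'' (w + 0 *\<^sub>R b) p (flip_x p)) (at_right 0)"
    unfolding continuous_on_def at_within_Icc_at_right[OF zero_less_one, symmetric]
    by (rule bspec) simp
  then show ?thesis
    using interior
    by (intro tendsto_upperbound[of "\<lambda>\<epsilon>. f'' (w + \<epsilon> *\<^sub>R b) p (flip_x p)" _ "at_right (0::real)"])
      (auto simp: eventually_at_right_field intro!: exI[of _ 1])
qed

lemma H_mat_kernel:
  assumes "w \<in> saddle_domain" "f'' w (u, v, t) (flip_x (u, v, t)) = 0"
  shows "H_mat F w *v concat_vec u (concat_vec v t) = 0"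
proof (rule negative_semidefinite_kernel)
  show "(H_mat F w *v p) \<bullet> q = (H_mat F w *v q) \<bullet> p" for p q
    using assms(1) by (rule H_mat_symmetric)
  show "(H_mat F w *v p) \<bullet> p \<le> 0" for p
    using H_mat_quadratic[OF assms(1)] f''_flip_nonpos[OF assms(1)] by (metis concat_vec_surj)
  show "(H_mat F w *v concat_vec u (concat_vec v t)) \<bullet> concat_vec u (concat_vec v t) = 0"
    using H_mat_quadratic[OF assms(1)] assms(2) by simp
qed

text \<open>On the segment from \<open>p\<close> to \<open>p + d\<close> the function \<open>\<psi>\<close> is nonincreasing; equality at the ends makes it
  constant, so its derivative, the quadratic form of \<open>H\<close> at \<open>d\<close>, vanishes along the whole segment and
  \<open>d\<close> is in the kernel of \<open>H\<close> at each of its points, not just of the average.\<close>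

lemma H_bar_kernel:
  assumes w: "(x, y, z) \<in> saddle_domain" and v: "(x', y', z') \<in> saddle_domain"
    and zero: "(saddle_operator F (x, y, z) - saddle_operator F (x', y', z'))
      \<bullet> ((x, y, z) - (x', y', z')) = 0"
  shows "concat_vec (x - x') (concat_vec (y - y') (z - z')) \<in> matrix_ker (H_bar F (x, y, z) (x', y', z'))"
proof -
  define p where "p = (x', y', z')"
  define d where "d = (x, y, z) - p"
  have d: "d = (x - x', y - y', z - z')"
    unfolding d_def p_def by simp
  have seg: "p + s *\<^sub>R d \<in> saddle_domain" if "s \<in> {0..1}" for s
    unfolding d_def p_def using saddle_domain_segment[OF v w that] .
  define \<psi> where "\<psi> = (\<lambda>s. saddle_operator F (p + s *\<^sub>R d) \<bullet> d)"
  have "\<psi> 1 = \<psi> 0"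
    using zero unfolding \<psi>_def d_def p_def by (simp add: inner_diff_left)
  then have const: "\<psi> s = \<psi> 0" if "s \<in> {0..1}" for s
    using saddle_operator_antimono_along_line[of p 0 d s]
      saddle_operator_antimono_along_line[of p s d 1] seg[of 0] seg[of s] seg[of 1] that
    unfolding \<psi>_def by simp
  have "H_mat F (p + s *\<^sub>R d) *v concat_vec (x - x') (concat_vec (y - y') (z - z')) = 0"
    if s: "s \<in> {0..1}" for s
  proof (rule H_mat_kernel[OF seg[OF s]])
    have "(\<psi> has_vector_derivative f'' (p + s *\<^sub>R d) d (flip_x d)) (at s within {0..1})"
      unfolding \<psi>_def using seg s by (intro saddle_operator_along_line) auto
    moreover have "(\<psi> has_vector_derivative 0) (at s within {0..1})"
      by (rule has_vector_derivative_transform[OF s _ has_vector_derivative_const[of "\<psi> 0"]]) (rule const)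
    ultimately show "f'' (p + s *\<^sub>R d) (x - x', y - y', z - z') (flip_x (x - x', y - y', z - z')) = 0"
      using vector_derivative_unique_within_closed_interval[of 0 1 s \<psi>] s unfolding d by auto
  qed
  then show ?thesis
    unfolding matrix_ker_def H_bar_def d_def p_def
    by (auto intro!: integral_matrix_vector_mult_eq_0)
qed

section \<open>Saddle points\<close>

text \<open>First-order optimality of \<open>p\<close>: \<open>F\<close> does not decrease when \<open>x\<close> alone moves away from \<open>p\<close>, and does not
  increase when \<open>(y, z)\<close> alone moves within the domain.\<close>

lemma Saddle_variational_inequality:
  assumes p: "p \<in> Saddle F" and w: "w \<in> saddle_domain"
  shows "saddle_operator F p \<bullet> (w - p) \<le> 0"
proof -
  obtain x y z x' y' z' where p_eq: "p = (x, y, z)" and w_eq: "w = (x', y', z')"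
    using prod_cases3 by metis
  have y: "y \<in> nonneg_orthant" "y' \<in> nonneg_orthant"
    using subsetD[OF Saddle_subset p] w unfolding p_eq w_eq saddle_domain_iff by auto
  have max: "F (x, b, c) \<le> F (x, y, z)" and min: "F (x, y, z) \<le> F (a, y, z)"
    if "b \<in> nonneg_orthant" for a b c
    using p that unfolding p_eq Saddle_def by blast+
  note p_dom = subsetD[OF Saddle_subset p]
  have "- f' p (x' - x, 0, 0) \<le> 0"
  proof (rule directional_derivative_le[OF has_derivative_minus[OF deriv[OF p_dom]], of 1])
    show "p + t *\<^sub>R (x' - x, 0, 0) \<in> saddle_domain" for t
      using y by (simp add: p_eq saddle_domain_iff)
    show "- F (p + t *\<^sub>R (x' - x, 0, 0)) \<le> - F p + t * 0" for t
      using min[OF y(1)] by (simp add: p_eq)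
  qed simp
  moreover have "f' p (0, y' - y, z' - z) \<le> 0"
  proof (rule directional_derivative_le[OF deriv[OF p_dom], of 1])
    fix t :: real assume t: "t \<in> {0..1}"
    have "(x, y, z) + t *\<^sub>R ((x, y', z') - (x, y, z)) \<in> saddle_domain"
      using y t by (intro saddle_domain_segment) (auto simp: saddle_domain_iff)
    then have in_orthant: "y + t *\<^sub>R (y' - y) \<in> nonneg_orthant"
      by (simp add: saddle_domain_iff)
    then show "p + t *\<^sub>R (0, y' - y, z' - z) \<in> saddle_domain"
      by (simp add: p_eq saddle_domain_iff)
    show "F (p + t *\<^sub>R (0, y' - y, z' - z)) \<le> F p + t * 0"
      using max[OF in_orthant] by (simp add: p_eq)
  qed simp
  moreover have "flip_x (w - p) = (0, y' - y, z' - z) - (x' - x, 0, 0)"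
    unfolding p_eq w_eq by simp
  then have "f' p (flip_x (w - p)) = f' p (0, y' - y, z' - z) - f' p (x' - x, 0, 0)"
    by (simp only: blinfun.diff_right)
  ultimately show ?thesis
    unfolding saddle_operator_inner[OF p_dom] by linarith
qed

text \<open>The variational inequality is tested with points that differ from \<open>p\<close> by a gradient in \<open>x\<close> or \<open>z\<close>, or in
  one coordinate of \<open>y\<close>. The latter gives \<open>grad_y F p $ i \<le> 0\<close>, with equality if \<open>y $ i > 0\<close>.\<close>

lemma Saddle_equilibrium:
  assumes p: "p \<in> Saddle F"
  shows "psp_field F p = 0"
proof -
  obtain x y z where p_eq: "p = (x, y, z)"
    using prod_cases3 by metis
  have y: "y \<in> nonneg_orthant"
    using subsetD[OF Saddle_subset p] unfolding p_eq saddle_domain_iff .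
  note VI = Saddle_variational_inequality[OF p, unfolded p_eq saddle_operator_def]
  have zero: "a = 0" if "a \<bullet> a \<le> 0" for a :: "'c::real_inner"
    using that inner_gt_zero_iff[of a] by (meson not_less)
  have "grad_x F p = 0"
    using VI[of "(x - grad_x F p, y, z)"] y by (intro zero) (simp add: saddle_domain_iff p_eq)
  moreover have "grad_z F p = 0"
    using VI[of "(x, y, z + grad_z F p)"] y by (intro zero) (simp add: saddle_domain_iff p_eq)
  moreover have "pos_proj_vec (grad_y F p) y = 0"
  proof -
    have "pos_proj (grad_y F p $ i) (y $ i) = 0" for i
    proof -
      have single: "grad_y F p $ i * c \<le> 0" if "y $ i + c \<ge> 0" for c
      proof -
        have "y + c *\<^sub>R axis i 1 \<in> nonneg_orthant"
          using y that unfolding nonneg_orthant_def by (auto simp: axis_def)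
        then show ?thesis
          using VI[of "(x, y + c *\<^sub>R axis i 1, z)"]
          by (simp add: saddle_domain_iff p_eq inner_axis mult.commute)
      qed
      have "y $ i \<ge> 0"
        using y unfolding nonneg_orthant_def by simp
      then have "grad_y F p $ i \<le> 0" and "grad_y F p $ i * (- y $ i) \<le> 0"
        using single[of 1] single[of "- y $ i"] by auto
      then show ?thesis
        using \<open>y $ i \<ge> 0\<close> by (auto simp: pos_proj_def max_def zero_le_mult_iff)
    qed
    then show ?thesis
      unfolding pos_proj_vec_def by (simp add: vec_eq_iff)
  qed
  ultimately show ?thesis
    unfolding p_eq psp_field_def by (simp add: zero_prod_def)
qed

section \<open>Stability and omega-limit sets\<close>

lemma continuous_f': "continuous_on saddle_domain f'"
  by (rule has_derivative_continuous_on) (rule deriv2)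

text \<open>\<open>|X w| \<le> |G w| \<le> |f' w|\<close>, and \<open>f'\<close> is continuous on the closed domain.\<close>

lemma bounded_psp_field:
  assumes "B \<subseteq> saddle_domain" "bounded B"
  shows "bounded (psp_field F ` B)"
proof -
  have "closure B \<subseteq> saddle_domain"
    using assms(1) closed_saddle_domain by (rule closure_minimal)
  then have "compact (f' ` closure B)"
    using assms(2) continuous_f' by (intro compact_continuous_image) (auto intro: continuous_on_subset)
  then have "bounded (f' ` closure B)"
    by (rule compact_imp_bounded)
  then obtain L where "\<forall>A\<in>f' ` closure B. norm A \<le> L"
    unfolding bounded_iff by blast
  then have L: "norm (f' w) \<le> L" if "w \<in> closure B" for w
    using that by blast
  have "norm (psp_field F w) \<le> L" if "w \<in> B" for w
  proof -
    have w: "w \<in> saddle_domain" "w \<in> closure B"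
      using that assms(1) closure_subset by auto
    have "norm (saddle_operator F w) * norm (saddle_operator F w) = f' w (flip_x (saddle_operator F w))"
      using saddle_operator_inner[OF w(1), of "saddle_operator F w"]
      by (simp flip: power2_norm_eq_inner power2_eq_square)
    also have "\<dots> \<le> norm (f' w) * norm (saddle_operator F w)"
      using norm_blinfun[of "f' w" "flip_x (saddle_operator F w)"] by (simp add: norm_flip_x)
    finally have "norm (saddle_operator F w) \<le> norm (f' w)"
      by (cases "saddle_operator F w = 0") auto
    then show ?thesis
      using L[OF w(2)] norm_psp_field_le[of F w] by linarith
  qed
  then show ?thesis
    unfolding bounded_iff by blast
qed

lemma omega_limit_subset_E_set:
  assumes g: "caratheodory_solution (psp_field F) saddle_domain {0..} g"
    and nonempty: "Saddle F \<noteq> {}"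
  shows "omega_limit_set g \<subseteq> E_set F"
proof
  fix w assume w: "w \<in> omega_limit_set g"
  have main: "w \<in> saddle_domain \<and> (saddle_operator F w - saddle_operator F p) \<bullet> (w - p) = 0"
    if p: "p \<in> Saddle F" for p
  proof -
    note p_dom = subsetD[OF Saddle_subset p]
    define \<phi> where "\<phi> = (\<lambda>v. - ((saddle_operator F v - saddle_operator F p) \<bullet> (v - p)))"
    have "continuous_on saddle_domain (\<lambda>v. f' p (flip_x (v - p)) - f' v (flip_x (v - p)))"
      by (intro continuous_intros continuous_f' continuous_on_flip_x)
    also have "?this \<longleftrightarrow> continuous_on saddle_domain \<phi>"
      by (rule continuous_on_cong)
        (simp_all add: \<phi>_def inner_diff_left saddle_operator_inner p_dom)
    finally have cont: "continuous_on saddle_domain \<phi>" .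
    have nonneg: "\<phi> v \<ge> 0" if "v \<in> saddle_domain" for v
      using saddle_operator_dissipative that p_dom unfolding \<phi>_def dissipative_on_def by simp
    have diss: "psp_field F v \<bullet> (v - p) \<le> - \<phi> v" if "v \<in> saddle_domain" for v
      using psp_field_inner_le[OF that p_dom, of F] Saddle_variational_inequality[OF p that]
      unfolding \<phi>_def by (simp add: inner_diff_left)
    from omega_limit_no_dissipation[OF g closed_saddle_domain cont nonneg diss bounded_psp_field w]
    show ?thesis
      unfolding \<phi>_def by simp
  qed
  obtain x y z where w_eq: "w = (x, y, z)"
    using prod_cases3 by metis
  have "w \<in> saddle_domain"
    using main nonempty by blast
  moreover have "concat_vec (x - x') (concat_vec (y - y') (z - z')) \<in> matrix_ker (H_bar F w (x', y', z'))"
    if "(x', y', z') \<in> Saddle F" for x' y' z'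
    using H_bar_kernel[of x y z x' y' z'] main[OF that] subsetD[OF Saddle_subset that]
    unfolding w_eq by blast
  ultimately show "w \<in> E_set F"
    unfolding E_set_def w_eq by auto
qed

end

theorem proposition4p1:
  fixes F :: "(real^'n) \<times> (real^'p) \<times> (real^'m) \<Rightarrow> real"
  assumes "twice_cont_differentiable_on F saddle_domain"
    and "convex_concave F"
    and "Saddle F \<noteq> {}"
  shows "(\<forall>w\<in>Saddle F. lyapunov_stable (psp_field F) saddle_domain w)
       \<and> (\<forall>g. caratheodory_solution (psp_field F) saddle_domain {0..} g \<longrightarrow>
            omega_limit_set g \<subseteq> largest_invariant_subset (psp_field F) saddle_domain (E_set F))"
proof -
  obtain f' f'' where "C2_convex_concave F f' f''"
    using assms(1,2) unfolding twice_cont_differentiable_on_def C2_convex_concave_def by blast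
  then interpret C2_convex_concave F f' f'' .
  show ?thesis
  proof (intro conjI ballI allI impI)
    fix w assume "w \<in> Saddle F"
    then show "lyapunov_stable (psp_field F) saddle_domain w"
      using Saddle_subset by (intro dissipative_equilibrium_stable psp_field_dissipative Saddle_equilibrium) auto
  next
    fix g assume g: "caratheodory_solution (psp_field F) saddle_domain {0..} g"
    show "omega_limit_set g \<subseteq> largest_invariant_subset (psp_field F) saddle_domain (E_set F)"
      using omega_limit_subset_E_set[OF g assms(3)]
        dissipative_omega_limit_invariant[OF psp_field_dissipative g]
      by (rule largest_invariant_subset(3))
  qed
qed

end
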